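(* Let $A$ be a finite non-local commutative ring. Then the line graph $L(EG(A))$ of the essential graph of $A$ is outerplanar if and only if $A$ is isomorphic to one of the rings: $\mathbb{Z}_2\times\mathbb{Z}_2$, $\mathbb{Z}_2\times\mathbb{Z}_3$, $\mathbb{Z}_3\times\mathbb{Z}_3$, $\mathbb{Z}_2\times\mathbb{F}_4$, $\mathbb{Z}_2\times\mathbb{Z}_2\times\mathbb{Z}_2$.
   Context: All rings have unity $1\neq 0$. $\mathbb{Z}_n$ is the ring of integers modulo $n$ and $\mathbb{F}_n$ the finite field with $n$ elements. A ring is local if it has exactly one maximal ideal. An ideal $I$ of a commutative ring $A$ is essential if $I\cap J\neq 0$ for every non-zero ideal $J$ of $A$ (so $A$ itself is essential). For $s\in A$, $\mathrm{ann}_A(s)=\{r\in A : sr=0\}$. The essential graph $EG(A)$ is the simple undirected graph whose vertices are the non-zero zero-divisors of $A$, two distinct vertices $u,v$ being adjacent if and only if $\mathrm{ann}_A(uv)$ is an essential ideal of $A$. The line graph $L(G)$ of a graph $G$ has the edges of $G$ as vertices, two distinct ones being adjacent exactly when the corresponding edges share an endpoint in $G$. A graph is outerplanar if it can be drawn in the plane without edge crossings and with all vertices on the boundary of the unbounded region. *)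

theory Defs
  imports
    "HOL-Analysis.Analysis"
    "HOL-Algebra.QuotRing"
    "HOL-Algebra.Chinese_Remainder"
    "HOL-Number_Theory.Residues"
begin

section \<open>Commutative rings\<close>

definition local_ring :: "('a, 'b) ring_scheme \<Rightarrow> bool" where
  "local_ring A \<longleftrightarrow> (\<exists>!M. maximalideal M A)"

definition essential_ideal :: "'a set \<Rightarrow> ('a, 'b) ring_scheme \<Rightarrow> bool" where
  "essential_ideal I A \<longleftrightarrow>
     ideal I A \<and> (\<forall>J. ideal J A \<and> J \<noteq> {\<zero>\<^bsub>A\<^esub>} \<longrightarrow> I \<inter> J \<noteq> {\<zero>\<^bsub>A\<^esub>})"

definition ann :: "('a, 'b) ring_scheme \<Rightarrow> 'a \<Rightarrow> 'a set" where
  "ann A s = {r \<in> carrier A. s \<otimes>\<^bsub>A\<^esub> r = \<zero>\<^bsub>A\<^esub>}"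

definition nonzero_zero_divisors :: "('a, 'b) ring_scheme \<Rightarrow> 'a set" where
  "nonzero_zero_divisors A =
     {x \<in> carrier A. x \<noteq> \<zero>\<^bsub>A\<^esub> \<and> (\<exists>y \<in> carrier A. y \<noteq> \<zero>\<^bsub>A\<^esub> \<and> x \<otimes>\<^bsub>A\<^esub> y = \<zero>\<^bsub>A\<^esub>)}"

text \<open>The field with four elements, as \<open>\<int>\<^sub>2[\<omega>]\<close> with \<open>\<omega>\<^sup>2 = \<omega> + 1\<close>;
  the pair \<open>(a, b)\<close> stands for \<open>a + b \<omega>\<close>.\<close>

definition GF4 :: "(int \<times> int) ring" where
  "GF4 =
     \<lparr>carrier = {0, 1} \<times> {0, 1},
      monoid.mult = (\<lambda>(a, b) (c, d). ((a * c + b * d) mod 2, (a * d + b * c + b * d) mod 2)),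
      one = (1, 0),
      zero = (0, 0),
      add = (\<lambda>(a, b) (c, d). ((a + c) mod 2, (b + d) mod 2))\<rparr>"

lemma card_GF4: "card (carrier GF4) = 4"
  by (simp add: GF4_def card_cartesian_product)

lemma field_GF4: "field GF4"
proof -
  interpret cring GF4
  proof (intro cringI abelian_groupI comm_monoidI)
    fix x assume "x \<in> carrier GF4"
    then show "\<exists>y\<in>carrier GF4. y \<oplus>\<^bsub>GF4\<^esub> x = \<zero>\<^bsub>GF4\<^esub>"
      by (intro bexI[of _ x]) (auto simp: GF4_def)
  qed (simp_all add: GF4_def split_beta, force+)
  show ?thesis
  proof (rule cring_fieldI)
    show "Units GF4 = carrier GF4 - {\<zero>\<^bsub>GF4\<^esub>}"
      by (auto simp: GF4_def Units_def)
  qed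
qed

section \<open>Simple graphs\<close>

text \<open>A simple undirected graph is a vertex set together with a set of edges, each edge being a
  two-element set of vertices.\<close>

record 'v sgraph =
  vertices :: "'v set"
  edges :: "'v set set"

definition essential_graph :: "('a, 'b) ring_scheme \<Rightarrow> 'a sgraph" where
  "essential_graph A =
     \<lparr>vertices = nonzero_zero_divisors A,
      edges = {{u, v} | u v. u \<in> nonzero_zero_divisors A \<and> v \<in> nonzero_zero_divisors A \<and>
                 u \<noteq> v \<and> essential_ideal (ann A (u \<otimes>\<^bsub>A\<^esub> v)) A}\<rparr>"

definition line_graph :: "'v sgraph \<Rightarrow> 'v set sgraph" where
  "line_graph G =
     \<lparr>vertices = edges G,
      edges = {{e, f} | e f. e \<in> edges G \<and> f \<in> edges G \<and> e \<noteq> f \<and> e \<inter> f \<noteq> {}}\<rparr>"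

text \<open>A crossing-free drawing in the plane: \<open>p\<close> places the vertices at distinct points and
  \<open>\<gamma> e\<close> is a simple arc joining the two ends of \<open>e\<close>.  An arc contains no vertices but its own ends,
  and two arcs meet at most in common ends.\<close>

definition plane_drawing :: "'v sgraph \<Rightarrow> ('v \<Rightarrow> complex) \<Rightarrow> ('v set \<Rightarrow> real \<Rightarrow> complex) \<Rightarrow> bool" where
  "plane_drawing G p \<gamma> \<longleftrightarrow>
     inj_on p (vertices G) \<and>
     (\<forall>e \<in> edges G. arc (\<gamma> e) \<and> {pathstart (\<gamma> e), pathfinish (\<gamma> e)} = p ` e \<and>
        path_image (\<gamma> e) \<inter> p ` vertices G = p ` e) \<and>
     (\<forall>e \<in> edges G. \<forall>f \<in> edges G. e \<noteq> f \<longrightarrow>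
        path_image (\<gamma> e) \<inter> path_image (\<gamma> f) \<subseteq> p ` (e \<inter> f))"

definition drawing_image :: "'v sgraph \<Rightarrow> ('v \<Rightarrow> complex) \<Rightarrow> ('v set \<Rightarrow> real \<Rightarrow> complex) \<Rightarrow> complex set" where
  "drawing_image G p \<gamma> = p ` vertices G \<union> (\<Union>e \<in> edges G. path_image (\<gamma> e))"

text \<open>For a finite graph the drawing is compact, so its complement has exactly one unbounded
  component; this is the library's \<^const>\<open>outside\<close>.\<close>

definition outerplanar :: "'v sgraph \<Rightarrow> bool" where
  "outerplanar G \<longleftrightarrow>
     (\<exists>p \<gamma>. plane_drawing G p \<gamma> \<and>
        p ` vertices G \<subseteq> frontier (outside (drawing_image G p \<gamma>)))"

end

theory Submission
  imports Defs "HOL-Complex_Analysis.Winding_Numbers"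
begin

text \<open>The edges at a vertex of the essential graph are pairwise adjacent in its line graph, so the line graph
  contains \<open>K\<^sub>4\<close> as soon as a vertex has degree four, and it contains a prism as soon as the essential graph
  contains \<open>K\<^sub>2\<^sub>,\<^sub>3\<close>.  Neither \<open>K\<^sub>4\<close> nor the prism is outerplanar.  These two obstructions decide everything.

  A finite ring that is not local has a nontrivial idempotent \<open>e\<close>
  (\<open>idempotent_if_not_local\<close>) and splits as \<open>e R \<times> (1 - e) R\<close> (\<open>ring_iso_corners\<close>).  Nonzero elements of
  different factors have product zero, so the essential graph contains the complete bipartite graph between them
  (\<open>corner_card_bounds\<close>).  Hence neither factor has more than four elements, and three elements in one exclude
  four in the other.  Rings with two or three elements are prime fields.  A ring with four
  elements is the field, or \<open>\<int>\<^sub>2 \<times> \<int>\<^sub>2\<close>, or has a nonzero element of square zero (\<open>four_element_cases\<close>); such an element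
  would be adjacent to all other vertices, and there are at least four of them
  (\<open>not_outerplanar_if_square_zero\<close>).  This leaves the five rings.

  Conversely, the five rings are reduced, their essential graphs are the zero-divisor graphs, and the
  line graphs are complete graphs on at most three vertices, a four-cycle, and a hexagon with an inscribed
  triangle.  All of them can be drawn as noncrossing chords between points of a parabola, where the tangent at each point shows
  that it borders the unbounded region (\<open>outerplanar_if_noncrossing\<close>).

  The topological core is about theta curves, that is, three arcs with common ends: one of them runs inside the
  closed curve formed by the other two (\<open>some_interior_in_face\<close>).  This follows from the additivity of winding numbers.  In an
  outerplanar drawing no vertex is enclosed by a cycle, so there is no theta curve all of whose three paths
  have inner vertices, which excludes the prism (\<open>no_prism\<close>).  In \<open>K\<^sub>4\<close> two disjoint edges would both have to be
  diagonals inside the four-cycle of the remaining edges (\<open>no_K4\<close>).\<close>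

section \<open>Theta curves in the plane\<close>

lemma connected_subset_inside:
  fixes C :: "'a::real_normed_vector set"
  assumes "closed C" "connected S" "S \<inter> C = {}" "S \<inter> inside C \<noteq> {}"
  shows "S \<subseteq> inside C"
proof (rule ccontr)
  assume "\<not> S \<subseteq> inside C"
  then have "outside C \<inter> S \<noteq> {}"
    using assms(3) inside_Un_outside[of C] by blast
  moreover have "S \<subseteq> inside C \<union> outside C"
    using assms(3) inside_Un_outside[of C] by blast
  ultimately show False
    using connectedD[OF assms(2) open_inside[OF assms(1)] open_outside[OF assms(1)]]
      assms(4) inside_Int_outside[of C] by (metis Int_commute inf_assoc inf_bot_right)
qed

text \<open>The form in which outerplanarity is used: a vertex reached from the unbounded region cannot be
  enclosed by a part of the drawing.\<close>
lemma frontier_outside_not_inside: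
  fixes C :: "'a::real_normed_vector set"
  assumes "closed C" "C \<subseteq> D" "x \<in> frontier (outside D)"
  shows "x \<notin> inside C"
proof
  assume "x \<in> inside C"
  moreover have "x \<in> closure (outside D)"
    using assms(3) by (simp add: frontier_def)
  ultimately have "inside C \<inter> outside D \<noteq> {}"
    using open_Int_closure_eq_empty[OF open_inside[OF assms(1)], of "outside D"] by auto
  then show False
    using outside_mono[OF assms(2)] inside_Int_outside[of C] by blast
qed

text \<open>Three arcs with common ends that are otherwise disjoint.  Indexing them by \<open>0, 1, 2\<close> lets each
  of the symmetric statements below be made once, for an arbitrary choice of two arcs or of the third.\<close>
locale theta_curve =
  fixes a b :: complex and c :: "nat \<Rightarrow> real \<Rightarrow> complex"
  assumes arcs: "\<And>i. i < 3 \<Longrightarrow> arc (c i)"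
    and starts: "\<And>i. i < 3 \<Longrightarrow> pathstart (c i) = a"
    and finishes: "\<And>i. i < 3 \<Longrightarrow> pathfinish (c i) = b"
    and meets: "\<And>i j. i < 3 \<Longrightarrow> j < 3 \<Longrightarrow> i \<noteq> j \<Longrightarrow> path_image (c i) \<inter> path_image (c j) = {a, b}"
begin

definition face :: "nat \<Rightarrow> nat \<Rightarrow> complex set" where
  "face i j = inside (path_image (c i) \<union> path_image (c j))"

lemma face_commute: "face i j = face j i"
  by (simp add: face_def Un_commute)

lemma interior_nonempty: "i < 3 \<Longrightarrow> path_image (c i) - {a, b} \<noteq> {}"
  using nonempty_simple_path_endless[of "c i"] arc_imp_simple_path[OF arcs] starts finishes by auto

lemma interior_connected: "i < 3 \<Longrightarrow> connected (path_image (c i) - {a, b})"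
  using connected_simple_path_endless[of "c i"] arc_imp_simple_path[OF arcs] starts finishes by auto

lemma closed_pair: "i < 3 \<Longrightarrow> j < 3 \<Longrightarrow> closed (path_image (c i) \<union> path_image (c j))"
  using arcs closed_arc_image by blast

lemma loop:
  assumes "i < 3" "j < 3" "i \<noteq> j"
  shows "simple_path (c i +++ reversepath (c j))"
    and "pathfinish (c i +++ reversepath (c j)) = pathstart (c i +++ reversepath (c j))"
    and "path_image (c i +++ reversepath (c j)) = path_image (c i) \<union> path_image (c j)"
  using assms arcs starts finishes meets
  by (auto simp: simple_path_join_loop_eq path_image_join arc_reversepath)

lemma interior_subset_face:
  assumes "i < 3" "j < 3" "k < 3" "k \<noteq> i" "k \<noteq> j" "path_image (c k) \<inter> face i j \<noteq> {}" "i \<noteq> j"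
  shows "path_image (c k) - {a, b} \<subseteq> face i j"
  unfolding face_def
proof (rule connected_subset_inside)
  have "{a,b} \<subseteq> path_image (c i)"
    using meets[of i j] assms by auto
  then have "{a, b} \<inter> face i j = {}"
    unfolding face_def using inside_no_overlap[of "path_image (c i) \<union> path_image (c j)"] by blast
  then show "(path_image (c k) - {a, b}) \<inter> inside (path_image (c i) \<union> path_image (c j)) \<noteq> {}"
    using assms(6) unfolding face_def by blast
  show "(path_image (c k) - {a, b}) \<inter> (path_image (c i) \<union> path_image (c j)) = {}"
    using meets[of k i] meets[of k j] assms by blast
qed (use assms closed_pair interior_connected in auto)

text \<open>The three loops of a theta curve are dependent: the sum of the first two, with the middle arc
  cancelled, is the third.  Since each loop winds around a point exactly when the point lies in its face, no
  point off the curve can lie in exactly one of the three faces.  This is what replaces a count of the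
  components of the complement.\<close>
lemma winding_cycle:
  assumes "z \<notin> path_image (c 0) \<union> path_image (c 1) \<union> path_image (c 2)"
  shows "winding_number (c 0 +++ reversepath (c 1)) z + winding_number (c 1 +++ reversepath (c 2)) z
    = winding_number (c 0 +++ reversepath (c 2)) z"
  using assms arcs starts finishes
  by (simp add: winding_number_join winding_number_reversepath arc_imp_path)

lemma winding_eq_0_iff:
  assumes "i < 3" "j < 3" "i \<noteq> j" "z \<notin> path_image (c i) \<union> path_image (c j)"
  shows "winding_number (c i +++ reversepath (c j)) z = 0 \<longleftrightarrow> z \<notin> face i j"
proof (cases "z \<in> face i j")
  case True
  then show ?thesis
    using simple_closed_path_winding_number_inside[OF loop(1)[OF assms(1-3)]] loop(3)[OF assms(1-3)]
    unfolding face_def by (metis one_neq_zero neg_equal_0_iff_equal)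
next
  case False
  then have "z \<in> outside (path_image (c i +++ reversepath (c j)))"
    using assms(4) inside_Un_outside[of "path_image (c i) \<union> path_image (c j)"]
    unfolding face_def loop(3)[OF assms(1-3)] by blast
  then show ?thesis
    using False winding_number_zero_in_outside loop(1,2)[OF assms(1-3)] simple_path_imp_path by blast
qed

lemma faces_overlap:
  assumes "z \<in> face i j" "i < 3" "j < 3" "k < 3" "i \<noteq> j" "k \<noteq> i" "k \<noteq> j"
    and "z \<notin> path_image (c 0) \<union> path_image (c 1) \<union> path_image (c 2)"
  shows "z \<in> face i k \<or> z \<in> face j k"
proof -
  have "z \<notin> face 0 1 \<and> z \<notin> face 1 2 \<longrightarrow> z \<notin> face 0 2"
    "z \<notin> face 0 1 \<and> z \<notin> face 0 2 \<longrightarrow> z \<notin> face 1 2"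
    "z \<notin> face 1 2 \<and> z \<notin> face 0 2 \<longrightarrow> z \<notin> face 0 1"
    using winding_cycle[OF assms(8)] winding_eq_0_iff[of 0 1 z] winding_eq_0_iff[of 1 2 z]
      winding_eq_0_iff[of 0 2 z] assms(8) by auto
  moreover have "i = 0 \<or> i = 1 \<or> i = 2" "j = 0 \<or> j = 1 \<or> j = 2" "k = 0 \<or> k = 1 \<or> k = 2"
    using assms(2-4) by linarith+
  ultimately show ?thesis
    using assms(1,5-7) face_commute[of 1 0] face_commute[of 2 0] face_commute[of 2 1] by metis
qed

text \<open>If the third arc avoids the face of the first two, that face is a connected set off the curve, so
  one common point puts all of it inside the face of \<open>i\<close> and \<open>k\<close>.  Its frontier contains the arc \<open>j\<close>, which is
  thereby caught in the closure of the larger face.\<close>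
lemma interior_meets_face:
  assumes "i < 3" "j < 3" "k < 3" "i \<noteq> j" "k \<noteq> i" "k \<noteq> j" 
    and "path_image (c k) \<inter> face i j = {}" "z \<in> face i j" "z \<in> face i k"
  shows "path_image (c j) - {a, b} \<subseteq> face i k"
proof -
  have fc: "open (face i j)" "connected (face i j)" 
    and fr: "frontier (face i j) = path_image (c i) \<union> path_image (c j)"
    using Jordan_inside_outside[OF loop(1,2)[OF assms(1,2,4)]] loop(3)[OF assms(1,2,4)]
    by (auto simp: face_def)
  have "face i j \<inter> (path_image (c i) \<union> path_image (c k)) = {}"
    using inside_no_overlap[of "path_image (c i) \<union> path_image (c j)"] assms(7)
    unfolding face_def by blast
  then have sub: "face i j \<subseteq> face i k"
    unfolding face_def[of i k]
    using connected_subset_inside[OF closed_pair[OF assms(1,3)] fc(2)] assms(8,9)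
    unfolding face_def[of i k] by blast
  have "path_image (c j) \<subseteq> closure (face i k)"
    using fr closure_mono[OF sub] frontier_subset_eq by (metis closure_Un_frontier le_supE subset_trans)
  also have "closure (face i k) = face i k \<union> (path_image (c i) \<union> path_image (c k))"
    using Jordan_inside_outside[OF loop(1,2)[OF assms(1,3)]] loop(3)[OF assms(1,3)] assms(5)
    by (metis closure_Un_frontier face_def)
  finally show ?thesis
    using meets[of j i] meets[of j k] assms by blast
qed

text \<open>Every theta curve has a middle arc.  Either the third arc enters the face of the first two, or
  a point of that face lies in a second face as well, and then one of the first two arcs is the middle one.\<close>
lemma some_interior_in_face:
  obtains i j k where "i < 3" "j < 3" "k < 3" "i \<noteq> j" "k \<noteq> i" "k \<noteq> j"
    "path_image (c k) - {a, b} \<subseteq> face i j"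
proof (cases "path_image (c 2) \<inter> face 0 1 = {}")
  case False
  then show ?thesis
    using interior_subset_face[of 0 1 2] that[of 0 1 2] by auto
next
  case True
  obtain z where z: "z \<in> face 0 1"
    using Jordan_inside_outside[OF loop(1,2)[of 0 1]] loop(3)[of 0 1]
    by (auto simp: face_def)
  then have "z \<notin> path_image (c 0) \<union> path_image (c 1) \<union> path_image (c 2)"
    using True inside_no_overlap[of "path_image (c 0) \<union> path_image (c 1)"]
    unfolding face_def by blast
  then have "z \<in> face 0 2 \<or> z \<in> face 1 2"
    using faces_overlap[OF z, of 2] by simp
  then show ?thesis
  proof
    assume "z \<in> face 0 2"
    then have "path_image (c 1) - {a, b} \<subseteq> face 0 2"
      using interior_meets_face[of 0 1 2 z] z True by simp
    then show ?thesis
      using that[of 0 2 1] by simp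
  next
    assume "z \<in> face 1 2"
    then have "path_image (c 0) - {a, b} \<subseteq> face 1 2"
      using interior_meets_face[of 1 0 2 z] z True by (simp add: face_commute[of 1 0, simplified])
    then show ?thesis
      using that[of 1 2 0] by simp
  qed
qed

lemma face_split:
  assumes "i < 3" "j < 3" "k < 3" "k \<noteq> i" "k \<noteq> j" "i \<noteq> j" "path_image (c k) - {a, b} \<subseteq> face i j"
  shows "face i j \<subseteq> face i k \<union> face j k \<union> path_image (c k)" "face i k \<inter> face j k = {}"
proof -
  have ab: "a \<noteq> b"
    using arcs[of 0] starts[of 0] finishes[of 0] arc_distinct_ends by fastforce
  have ne: "path_image (c k) \<inter> inside (path_image (c i) \<union> path_image (c j)) \<noteq> {}"
    using assms(7) interior_nonempty[OF assms(3)] unfolding face_def by blast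
  note sp = arc_imp_simple_path[OF arcs]
  from split_inside_simple_closed_curve[OF
      sp[OF assms(1)] starts[OF assms(1)] finishes[OF assms(1)]
      sp[OF assms(2)] starts[OF assms(2)] finishes[OF assms(2)]
      sp[OF assms(3)] starts[OF assms(3)] finishes[OF assms(3)] ab
      meets[OF assms(1,2,6)] meets[OF assms(1,3) assms(4)[symmetric]]
      meets[OF assms(2,3) assms(5)[symmetric]] ne]
  have "inside (path_image (c i) \<union> path_image (c k)) \<inter> inside (path_image (c j) \<union> path_image (c k)) = {} \<and>
      inside (path_image (c i) \<union> path_image (c k)) \<union> inside (path_image (c j) \<union> path_image (c k)) \<union>
        (path_image (c k) - {a, b}) = inside (path_image (c i) \<union> path_image (c j))"
    by blast
  then show "face i j \<subseteq> face i k \<union> face j k \<union> path_image (c k)" "face i k \<inter> face j k = {}"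
    unfolding face_def by auto
qed

end

section \<open>Obstructions to outerplanarity\<close>

definition strokes :: "('v set \<Rightarrow> real \<Rightarrow> complex) \<Rightarrow> 'v set set \<Rightarrow> complex set" where
  "strokes \<gamma> E = (\<Union>e\<in>E. path_image (\<gamma> e))"

fun path_edges :: "'v list \<Rightarrow> 'v set set" where
  "path_edges (x # y # zs) = insert {x, y} (path_edges (y # zs))"
| "path_edges _ = {}"

lemma Union_path_edges: "\<Union>(path_edges xs) \<subseteq> set xs"
  by (induction xs rule: path_edges.induct) auto

lemma finite_path_edges: "finite (path_edges xs)"
  by (induction xs rule: path_edges.induct) auto

locale outerplanar_drawing =
  fixes G :: "'v sgraph" and p :: "'v \<Rightarrow> complex" and \<gamma> :: "'v set \<Rightarrow> real \<Rightarrow> complex"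
  assumes plane: "plane_drawing G p \<gamma>"
    and outer: "p ` vertices G \<subseteq> frontier (outside (drawing_image G p \<gamma>))"
begin

lemma arc_edge: "e \<in> edges G \<Longrightarrow> arc (\<gamma> e)"
  and ends_edge: "e \<in> edges G \<Longrightarrow> {pathstart (\<gamma> e), pathfinish (\<gamma> e)} = p ` e"
  and vertices_on_edge: "e \<in> edges G \<Longrightarrow> path_image (\<gamma> e) \<inter> p ` vertices G = p ` e"
  and edges_meet: "e \<in> edges G \<Longrightarrow> f \<in> edges G \<Longrightarrow> e \<noteq> f \<Longrightarrow>
        path_image (\<gamma> e) \<inter> path_image (\<gamma> f) \<subseteq> p ` (e \<inter> f)"
  using plane unfolding plane_drawing_def by auto

lemma inj_p: "inj_on p (vertices G)"
  using plane unfolding plane_drawing_def by auto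

lemma strokes_meet:
  assumes "E \<subseteq> edges G" "F \<subseteq> edges G" "E \<inter> F = {}"
  shows "strokes \<gamma> E \<inter> strokes \<gamma> F \<subseteq> p ` (\<Union>E \<inter> \<Union>F)"
proof
  fix z assume "z \<in> strokes \<gamma> E \<inter> strokes \<gamma> F"
  then obtain e f where "e \<in> E" "f \<in> F" "z \<in> path_image (\<gamma> e) \<inter> path_image (\<gamma> f)"
    unfolding strokes_def by auto
  then show "z \<in> p ` (\<Union>E \<inter> \<Union>F)"
    using edges_meet[of e f] assms by blast
qed

lemma vertex_not_inside:
  assumes "E \<subseteq> edges G" "finite E" "v \<in> vertices G"
  shows "p v \<notin> inside (strokes \<gamma> E)"
proof (rule frontier_outside_not_inside)
  show "closed (strokes \<gamma> E)"
    unfolding strokes_def using assms arc_edge closed_arc_image by (intro closed_UN) auto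
  show "strokes \<gamma> E \<subseteq> drawing_image G p \<gamma>"
    unfolding strokes_def drawing_image_def using assms(1) by auto
  show "p v \<in> frontier (outside (drawing_image G p \<gamma>))"
    using outer assms(3) by auto
qed

lemma arc_of_edge:
  assumes "{x, y} \<in> edges G"
  obtains g where "arc g" "pathstart g = p x" "pathfinish g = p y" "path_image g = path_image (\<gamma> {x, y})"
proof -
  have "pathstart (\<gamma> {x, y}) = p x \<and> pathfinish (\<gamma> {x, y}) = p y \<or>
      pathstart (\<gamma> {x, y}) = p y \<and> pathfinish (\<gamma> {x, y}) = p x"
    using ends_edge[OF assms] by (auto simp: doubleton_eq_iff)
  then show ?thesis
    using that[of "\<gamma> {x, y}"] that[of "reversepath (\<gamma> {x, y})"] arc_edge[OF assms]
    by (auto simp: arc_reversepath)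
qed

lemma arc_of_path:
  assumes "distinct xs" "2 \<le> length xs" "path_edges xs \<subseteq> edges G"
  obtains g where "arc g" "pathstart g = p (hd xs)" "pathfinish g = p (last xs)"
    "path_image g = strokes \<gamma> (path_edges xs)"
  using assms
proof (induction xs arbitrary: thesis rule: path_edges.induct)
  case (1 x y zs)
  obtain h where h: "arc h" "pathstart h = p x" "pathfinish h = p y" "path_image h = path_image (\<gamma> {x, y})"
    using arc_of_edge[of x y] "1.prems" by auto
  show ?case
  proof (cases "zs = []")
    case True
    then show ?thesis
      using h "1.prems"(1)[of h] by (simp add: strokes_def)
  next
    case False
    then have "2 \<le> length (y # zs)"
      by (cases zs) auto
    then obtain g where g: "arc g" "pathstart g = p y" "pathfinish g = p (last (y # zs))"
        "path_image g = strokes \<gamma> (path_edges (y # zs))"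
      using "1.IH" "1.prems" by auto
    have "{x, y} \<notin> path_edges (y # zs)"
      using Union_path_edges[of "y # zs"] "1.prems"(2) by auto
    then have "strokes \<gamma> {{x, y}} \<inter> strokes \<gamma> (path_edges (y # zs)) \<subseteq> p ` (\<Union>{{x, y}} \<inter> \<Union>(path_edges (y # zs)))"
      using "1.prems"(4) by (intro strokes_meet) auto
    also have "\<dots> \<subseteq> {p y}"
      using Union_path_edges[of "y # zs"] "1.prems"(2) by auto
    finally have "path_image h \<inter> path_image g \<subseteq> {pathstart g}"
      using g h by (simp add: strokes_def)
    then have "arc (h +++ g)"
      using h g by (simp add: arc_join)
    moreover have "path_image (h +++ g) = strokes \<gamma> (path_edges (x # y # zs))"
      using h g by (simp add: path_image_join strokes_def)
    ultimately show ?thesis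
      using "1.prems"(1)[of "h +++ g"] h g by simp
  qed
qed auto

lemma vertex_on_path:
  assumes "2 \<le> length xs" "path_edges xs \<subseteq> edges G" "x \<in> set xs"
  shows "p x \<in> strokes \<gamma> (path_edges xs)"
  using assms
proof (induction xs rule: path_edges.induct)
  case (1 u v zs)
  have "p ` {u, v} \<subseteq> path_image (\<gamma> {u, v})"
    using vertices_on_edge[of "{u, v}"] "1.prems" by auto
  moreover have "p x \<in> strokes \<gamma> (path_edges (v # zs))" if "x \<in> set zs"
    using "1.IH" "1.prems" that by (cases zs) auto
  ultimately show ?case
    using "1.prems"(3) by (auto simp: strokes_def)
qed auto

text \<open>Edge-disjointness is a separate requirement because two paths may both be the single edge \<open>a b\<close>.\<close>
definition theta_paths :: "(nat \<Rightarrow> 'v list) \<Rightarrow> 'v \<Rightarrow> 'v \<Rightarrow> bool" where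
  "theta_paths P a b \<longleftrightarrow>
     (\<forall>i<3. distinct (P i) \<and> 2 \<le> length (P i) \<and> path_edges (P i) \<subseteq> edges G \<and>
        hd (P i) = a \<and> last (P i) = b) \<and>
     (\<forall>i<3. \<forall>j<3. i \<noteq> j \<longrightarrow>
        path_edges (P i) \<inter> path_edges (P j) = {} \<and> set (P i) \<inter> set (P j) \<subseteq> {a, b})"

lemma theta_of_paths:
  assumes "theta_paths P a b"
  obtains c where "theta_curve (p a) (p b) c"
    "\<And>i. i < 3 \<Longrightarrow> path_image (c i) = strokes \<gamma> (path_edges (P i))"
proof -
  have paths: "distinct (P i) \<and> 2 \<le> length (P i) \<and> path_edges (P i) \<subseteq> edges G \<and>
      hd (P i) = a \<and> last (P i) = b" if "i < 3" for i
    using assms that unfolding theta_paths_def by blast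
  have disj: "path_edges (P i) \<inter> path_edges (P j) = {} \<and> set (P i) \<inter> set (P j) \<subseteq> {a, b}"
    if "i < 3" "j < 3" "i \<noteq> j" for i j
    using assms that unfolding theta_paths_def by blast
  have "\<exists>g. arc g \<and> pathstart g = p a \<and> pathfinish g = p b \<and> path_image g = strokes \<gamma> (path_edges (P i))"
    if "i < 3" for i
    using arc_of_path[of "P i"] paths[OF that] by metis
  then obtain c where c: "\<And>i. i < 3 \<Longrightarrow> arc (c i) \<and> pathstart (c i) = p a \<and> pathfinish (c i) = p b \<and>
      path_image (c i) = strokes \<gamma> (path_edges (P i))"
    by metis
  have "theta_curve (p a) (p b) c"
  proof
    fix i j :: nat assume ij: "i < 3" "j < 3" "i \<noteq> j"
    have "strokes \<gamma> (path_edges (P i)) \<inter> strokes \<gamma> (path_edges (P j))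
        \<subseteq> p ` (\<Union>(path_edges (P i)) \<inter> \<Union>(path_edges (P j)))"
      using paths disj ij by (intro strokes_meet) auto
    also have "\<dots> \<subseteq> p ` {a, b}"
      using Union_path_edges[of "P i"] Union_path_edges[of "P j"] disj[OF ij] by blast
    finally show "path_image (c i) \<inter> path_image (c j) = {p a, p b}"
      using c[OF ij(1)] c[OF ij(2)] pathstart_in_path_image pathfinish_in_path_image by (metis (no_types, lifting) Int_iff empty_subsetI image_empty image_insert insert_subset subset_antisym)
  qed (use c in auto)
  then show ?thesis
    using that c by blast
qed

text \<open>Three internally disjoint paths between two vertices draw a theta curve.  Its middle path lies inside
  the cycle of the other two, so outerplanarity forbids it any inner vertex.\<close>
lemma theta_path_without_inner_vertex:
  assumes "theta_paths P a b"
    and "theta_curve (p a) (p b) c" "\<And>i. i < 3 \<Longrightarrow> path_image (c i) = strokes \<gamma> (path_edges (P i))"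
    and "a \<in> vertices G" "b \<in> vertices G"
  obtains i j k where "i < 3" "j < 3" "k < 3" "i \<noteq> j" "k \<noteq> i" "k \<noteq> j"
    "path_image (c k) - {p a, p b} \<subseteq> theta_curve.face c i j"
    "set (P k) \<inter> vertices G \<subseteq> {a, b}"
proof -
  interpret theta_curve "p a" "p b" c by fact
  have paths: "distinct (P i) \<and> 2 \<le> length (P i) \<and> path_edges (P i) \<subseteq> edges G" if "i < 3" for i
    using assms(1) that unfolding theta_paths_def by blast
  obtain i j k where ijk: "i < 3" "j < 3" "k < 3" "i \<noteq> j" "k \<noteq> i" "k \<noteq> j"
    "path_image (c k) - {p a, p b} \<subseteq> face i j"
    using some_interior_in_face by metis
  have face: "face i j = inside (strokes \<gamma> (path_edges (P i) \<union> path_edges (P j)))"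
    using assms(3) ijk(1,2) by (simp add: face_def strokes_def)
  have "v \<in> {a, b}" if "v \<in> set (P k)" "v \<in> vertices G" for v
  proof (rule ccontr)
    assume v: "v \<notin> {a, b}"
    have "p v \<in> path_image (c k)"
      using vertex_on_path[of "P k" v] paths assms(3) ijk(3) that by auto
    moreover have "p v \<notin> {p a, p b}"
      using inj_on_eq_iff[OF inj_p] that assms(4,5) v by auto
    ultimately have "p v \<in> face i j"
      using ijk by auto
    moreover have "p v \<notin> inside (strokes \<gamma> (path_edges (P i) \<union> path_edges (P j)))"
      by (intro vertex_not_inside) (use paths ijk that finite_path_edges in auto)
    ultimately show False
      using face by simp
  qed
  then show ?thesis
    using that ijk by blast
qed

lemma no_theta_with_inner_vertices:
  assumes "theta_paths P a b"
    and "a \<in> vertices G" "b \<in> vertices G"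
    and "\<And>i. i < 3 \<Longrightarrow> \<not> set (P i) \<inter> vertices G \<subseteq> {a, b}"
  shows False
proof -
  obtain c where "theta_curve (p a) (p b) c"
      "\<And>i. i < 3 \<Longrightarrow> path_image (c i) = strokes \<gamma> (path_edges (P i))"
    using theta_of_paths[OF assms(1)] by metis
  then show False
    using theta_path_without_inner_vertex[OF assms(1)] assms(2-4) by metis
qed

text \<open>The edge \<open>a b\<close> and the paths through \<open>c\<close> and through \<open>d\<close> form a theta curve.  Only the edge lacks an
  inner vertex, so it is the middle arc: a diagonal that cuts the inside of the four-cycle into two triangles.\<close>
lemma K4_diagonal:
  assumes "distinct [a, b, c, d]" "{a, b, c, d} \<subseteq> vertices G"
    and "{a, b} \<in> edges G" "{a, c} \<in> edges G" "{c, b} \<in> edges G" "{a, d} \<in> edges G" "{d, b} \<in> edges G"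
  defines "S \<equiv> strokes \<gamma> {{a, b}} - {p a, p b}"
  defines "I \<equiv> inside (strokes \<gamma> {{a, c}, {c, b}, {a, d}, {d, b}})"
  defines "U \<equiv> inside (strokes \<gamma> {{a, c}, {c, b}, {a, b}})"
  defines "V \<equiv> inside (strokes \<gamma> {{a, d}, {d, b}, {a, b}})"
  shows "S \<subseteq> I" "I \<subseteq> U \<union> V \<union> strokes \<gamma> {{a, b}}" "U \<inter> V = {}"
proof -
  define P where "P = (\<lambda>i. [[a, b], [a, c, b], [a, d, b]] ! i)"
  have P: "P 0 = [a, b]" "P 1 = [a, c, b]" "P 2 = [a, d, b]" "P (Suc 0) = [a, c, b]"
    by (simp_all add: P_def)
  have less3: "i < 3 \<longleftrightarrow> i = 0 \<or> i = 1 \<or> i = 2" for i :: nat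
    by auto
  have paths: "distinct (P i) \<and> 2 \<le> length (P i) \<and> path_edges (P i) \<subseteq> edges G \<and>
      hd (P i) = a \<and> last (P i) = b" if "i < 3" for i
    using that assms(1,3-7) unfolding less3 by (auto simp: P)
  have disj: "path_edges (P i) \<inter> path_edges (P j) = {} \<and> set (P i) \<inter> set (P j) \<subseteq> {a, b}"
    if "i < 3" "j < 3" "i \<noteq> j" for i j
    using that assms(1) unfolding less3 by (elim disjE) (auto simp: P doubleton_eq_iff)
  have theta: "theta_paths P a b"
    using paths disj unfolding theta_paths_def by blast
  obtain g where g: "theta_curve (p a) (p b) g"
      "\<And>i. i < 3 \<Longrightarrow> path_image (g i) = strokes \<gamma> (path_edges (P i))"
    using theta_of_paths[OF theta] by metis
  interpret theta_curve "p a" "p b" g by fact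
  obtain i j k where ijk: "i < 3" "j < 3" "k < 3" "i \<noteq> j" "k \<noteq> i" "k \<noteq> j"
      "path_image (g k) - {p a, p b} \<subseteq> face i j"
      "set (P k) \<inter> vertices G \<subseteq> {a, b}"
    using theta_path_without_inner_vertex[OF theta g] assms(2) by (metis insert_subset)
  have "k = 0"
    using ijk(3,8) assms(1,2) unfolding less3 by (auto simp: P)
  then have "face i j = face 1 2"
    using ijk(1,2,4-6) face_commute unfolding less3 by auto
  then have sub: "path_image (g 0) - {p a, p b} \<subseteq> face 1 2"
    using ijk(7) \<open>k = 0\<close> by simp
  have im: "path_image (g 0) = strokes \<gamma> {{a, b}}"
      "face 1 2 = I" "face 1 0 = U" "face 2 0 = V"
    using g(2)[of 0] g(2)[of 1] g(2)[of 2]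
    by (simp_all add: P face_def I_def U_def V_def strokes_def Un_ac)
  show "S \<subseteq> I" "I \<subseteq> U \<union> V \<union> strokes \<gamma> {{a, b}}" "U \<inter> V = {}"
    using sub face_split[of 1 2 0] unfolding im S_def by auto
qed

text \<open>Both \<open>a b\<close> and \<open>c d\<close> are diagonals of the four-cycle \<open>a c b d\<close>.  As they do not meet, \<open>c d\<close> stays in one of
  the two triangles cut off by \<open>a b\<close>, and its end that is not a corner of that triangle is enclosed by it.\<close>
lemma no_K4:
  assumes "distinct [a, b, c, d]" "{a, b, c, d} \<subseteq> vertices G"
    and "{a, b} \<in> edges G" "{a, c} \<in> edges G" "{a, d} \<in> edges G"
    and "{b, c} \<in> edges G" "{b, d} \<in> edges G" "{c, d} \<in> edges G"
  shows False
proof -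
  define S where "S = strokes \<gamma> {{c, d}} - {p c, p d}"
  define U where "U = inside (strokes \<gamma> {{a, c}, {c, b}, {a, b}})"
  define V where "V = inside (strokes \<gamma> {{a, d}, {d, b}, {a, b}})"
  obtain g where g: "arc g" "pathstart g = p c" "pathfinish g = p d" "path_image g = path_image (\<gamma> {c, d})"
    using arc_of_edge[OF assms(8)] by metis
  have S: "S = g ` {0<..<1}" "connected S" "S \<noteq> {}"
    using g simple_path_endless[of g] connected_simple_path_endless[of g]
      nonempty_simple_path_endless[of g] arc_imp_simple_path[OF g(1)]
    by (auto simp: S_def strokes_def)
  have sub: "S \<subseteq> inside (strokes \<gamma> {{a, c}, {c, b}, {a, d}, {d, b}})"
    using K4_diagonal(1)[of c d a b] assms unfolding S_def
    by (auto simp: insert_commute)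
  have "strokes \<gamma> {{c, d}} \<inter> strokes \<gamma> {{a, b}} \<subseteq> p ` (\<Union>{{c, d}} \<inter> \<Union>{{a, b}})"
    by (rule strokes_meet) (use assms in \<open>auto simp: doubleton_eq_iff\<close>)
  then have "S \<inter> strokes \<gamma> {{a, b}} = {}"
    using assms(1) by (auto simp: S_def)
  then have SUV: "S \<subseteq> U \<union> V" and UV: "U \<inter> V = {}"
    using sub K4_diagonal(2,3)[of a b c d] assms unfolding U_def V_def
    by (auto simp: insert_commute)
  have cl: "closed (strokes \<gamma> E)" if "E \<subseteq> edges G" "finite E" for E
    unfolding strokes_def using that arc_edge closed_arc_image by (intro closed_UN) auto
  have opn: "open U" "open V"
    unfolding U_def V_def using assms by (auto intro!: open_inside cl simp: insert_commute)
  (* The open diagonal lies in an open triangle; its ends are recovered as limit points. *)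
  have ends: "p c \<in> closure S" "p d \<in> closure S"
  proof -
    have "g ` closure {0<..<1} \<subseteq> closure S"
      using arc_imp_path[OF g(1)] unfolding S(1) path_def 
      by (intro image_closure_subset) (auto simp: closure_subset)
    moreover have "g 0 \<in> g ` closure {0<..<1}" "g 1 \<in> g ` closure {0<..<1}"
      by simp_all
    ultimately show "p c \<in> closure S" "p d \<in> closure S"
      using g(2,3) unfolding pathstart_def pathfinish_def by auto
  qed
  have edge_out: "p v \<notin> path_image (\<gamma> e)" if "e \<in> edges G" "v \<in> vertices G" "v \<notin> e" "e \<subseteq> vertices G" for v e
    using vertices_on_edge[OF that(1)] inj_on_image_mem_iff[OF inj_p that(2,4)] that by auto
  have limit: "v \<in> \<Union>E" if "p v \<in> closure (inside (strokes \<gamma> E))" "E \<subseteq> edges G" "finite E" "v \<in> vertices G" 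
    "\<Union>E \<subseteq> vertices G" for v E
  proof (rule ccontr)
    assume v: "v \<notin> \<Union>E"
    have "p v \<notin> strokes \<gamma> E"
      using edge_out that v unfolding strokes_def by blast
    then show False
      using closure_inside_subset[OF cl[OF that(2,3)]] that(1) vertex_not_inside[OF that(2,3,4)] by auto
  qed
  consider "S \<subseteq> U" | "S \<subseteq> V"
    using connectedD[OF S(2) opn] SUV UV by blast
  then show False
  proof cases
    case 1
    then have "p d \<in> closure U"
      using ends(2) closure_mono by blast
    then show False
      using limit[of d "{{a, c}, {c, b}, {a, b}}"] assms unfolding U_def by (auto simp: insert_commute)
  next
    case 2
    then have "p c \<in> closure V"
      using ends(1) closure_mono by blast
    then show False
      using limit[of c "{{a, d}, {d, b}, {a, b}}"] assms unfolding V_def by (auto simp: insert_commute)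
  qed
qed

text \<open>The prism contains a subdivision of \<open>K\<^sub>2\<^sub>,\<^sub>3\<close>: from a corner of one triangle to a corner of the other that
  is not its partner there are three internally disjoint paths, each with an inner vertex.\<close>
lemma no_prism:
  assumes "distinct [a1, a2, a3, b1, b2, b3]" "{a1, a2, a3, b1, b2, b3} \<subseteq> vertices G"
    and "{a1, a2} \<in> edges G" "{a2, b2} \<in> edges G" "{a1, b1} \<in> edges G" "{b1, b2} \<in> edges G"
    and "{a1, a3} \<in> edges G" "{a3, b3} \<in> edges G" "{b3, b2} \<in> edges G"
  shows False
proof -
  define P where "P = (\<lambda>i. [[a1, a2, b2], [a1, b1, b2], [a1, a3, b3, b2]] ! i)"
  have P: "P 0 = [a1, a2, b2]" "P (Suc 0) = [a1, b1, b2]" "P 2 = [a1, a3, b3, b2]"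
    by (simp_all add: P_def)
  have less3: "i < 3 \<longleftrightarrow> i = 0 \<or> i = Suc 0 \<or> i = 2" for i :: nat
    by auto
  have paths: "distinct (P i) \<and> 2 \<le> length (P i) \<and> path_edges (P i) \<subseteq> edges G \<and>
      hd (P i) = a1 \<and> last (P i) = b2" if "i < 3" for i
    using that assms(1,3-) unfolding less3 by (auto simp: P)
  have disj: "path_edges (P i) \<inter> path_edges (P j) = {} \<and> set (P i) \<inter> set (P j) \<subseteq> {a1, b2}"
    if "i < 3" "j < 3" "i \<noteq> j" for i j
    using that assms(1) unfolding less3 by (elim disjE) (auto simp: P doubleton_eq_iff)
  have inner: "\<not> set (P i) \<inter> vertices G \<subseteq> {a1, b2}" if "i < 3" for i
    using that assms(1,2) unfolding less3 by (auto simp: P)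
  have "theta_paths P a1 b2"
    using paths disj unfolding theta_paths_def by blast
  then show False
    using no_theta_with_inner_vertices[of P a1 b2] inner assms(2) by simp
qed

end

lemma outerplanar_drawing_exists:
  "outerplanar G \<longleftrightarrow> (\<exists>p \<gamma>. outerplanar_drawing G p \<gamma>)"
  by (simp add: outerplanar_def outerplanar_drawing_def)

section \<open>Noncrossing chords of a parabola\<close>

text \<open>A convex curve on which all computations are polynomial: the chord from \<open>s\<close> to \<open>t\<close> is the line
  \<open>y = (s + t) x - s t\<close>, and the point with parameter \<open>r\<close> lies above, on or below it according to the sign of
  \<open>(r - s) (r - t)\<close>.\<close>
definition parabola :: "real \<Rightarrow> complex" where
  "parabola t = Complex t (t\<^sup>2)"

lemma parabola_eq_iff [simp]: "parabola s = parabola t \<longleftrightarrow> s = t"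
  by (auto simp: parabola_def)

lemma chord_equation:
  assumes "z \<in> closed_segment (parabola s) (parabola t)"
  shows "Im z = (s + t) * Re z - s * t"
proof -
  obtain u where "z = (1 - u) *\<^sub>R parabola s + u *\<^sub>R parabola t"
    using assms by (auto simp: in_segment)
  then show ?thesis
    by (simp only:) (simp add: parabola_def power2_eq_square algebra_simps)
qed

lemma chord_above_tangent:
  assumes "z \<in> closed_segment (parabola s) (parabola t)"
  shows "Im z \<ge> 2 * r * Re z - r\<^sup>2"
proof -
  obtain u where u: "0 \<le> u" "u \<le> 1" "z = (1 - u) *\<^sub>R parabola s + u *\<^sub>R parabola t"
    using assms by (auto simp: in_segment)
  have "Im z - (2 * r * Re z - r\<^sup>2) = (1 - u) * (s - r)\<^sup>2 + u * (t - r)\<^sup>2"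
    unfolding u(3) by (simp add: parabola_def power2_eq_square algebra_simps)
  also have "\<dots> \<ge> 0"
    using u by simp
  finally show ?thesis by simp
qed

lemma parabola_on_chord:
  assumes "parabola r \<in> closed_segment (parabola s) (parabola t)"
  shows "r = s \<or> r = t"
proof -
  have "(r - s) * (r - t) = 0"
    using chord_equation[OF assms] by (simp add: parabola_def power2_eq_square algebra_simps)
  then show ?thesis by simp
qed

text \<open>The sign hypothesis says that the second chord does not cross the line of the first, so the two can
  meet only at an end of the second that lies on that line.\<close>
lemma chords_meet:
  assumes "z \<in> closed_segment (parabola s) (parabola t)" "z \<in> closed_segment (parabola s') (parabola t')"
    and "0 \<le> ((s' - s) * (s' - t)) * ((t' - s) * (t' - t))" "{s, t} \<noteq> {s', t'}" "s' \<noteq> t'"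
  shows "z \<in> parabola ` ({s, t} \<inter> {s', t'})"
proof -
  obtain u where u: "0 \<le> u" "u \<le> 1" "z = (1 - u) *\<^sub>R parabola s' + u *\<^sub>R parabola t'"
    using assms(2) by (auto simp: in_segment)
  (* A and B measure how far the ends of the second chord lie off the line of the first;
     the common point z is a convex combination at which this measure vanishes. *)
  define A where "A = (s' - s) * (s' - t)"
  define B where "B = (t' - s) * (t' - t)"
  have "(1 - u) * A + u * B = 0"
    using chord_equation[OF assms(1)] u(3) 
    by (simp add: A_def B_def parabola_def power2_eq_square algebra_simps)
  moreover have "0 \<le> A * B"
    using assms(3) by (simp add: A_def B_def)
  ultimately have "u = 0 \<or> u = 1 \<or> A = 0 \<and> B = 0"
  proof -
    have "((1 - u) * A) * (u * B) = - ((u * B) * (u * B))"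
      using \<open>(1 - u) * A + u * B = 0\<close> by (metis add_eq_0_iff2 mult_minus_left)
    then have "((1 - u) * u) * (A * B) = - ((u * B)\<^sup>2)"
      by (simp add: power2_eq_square algebra_simps)
    moreover have "((1 - u) * u) * (A * B) \<ge> 0"
      using u \<open>0 \<le> A * B\<close> by simp
    ultimately have "(u * B)\<^sup>2 = 0"
      by (metis neg_0_le_iff_le order_antisym zero_le_power2)
    then have "u * B = 0" "(1 - u) * A = 0"
      using \<open>(1 - u) * A + u * B = 0\<close> by auto
    then show ?thesis by auto
  qed
  then consider "u = 0" | "u = 1" | "A = 0" "B = 0" by blast
  then show ?thesis
  proof cases
    case 1
    then have "z = parabola s'" using u by simp
    then show ?thesis using parabola_on_chord[of s' s t] assms(1) by auto
  next
    case 2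
    then have "z = parabola t'" using u by simp
    then show ?thesis using parabola_on_chord[of t' s t] assms(1) by auto
  next
    case 3
    then show ?thesis using assms(4,5) by (auto simp: A_def B_def)
  qed
qed

lemma noncrossing_sign:
  fixes s t s' t' :: real
  assumes "\<And>a b c d. {a, c} = {s, t} \<and> {b, d} = {s', t'} \<or> {a, c} = {s', t'} \<and> {b, d} = {s, t} \<Longrightarrow>
     \<not> (a < b \<and> b < c \<and> c < d)"
  shows "0 \<le> ((s' - s) * (s' - t)) * ((t' - s) * (t' - t))"
proof -
  have neg: "(x - s) * (x - t) < 0 \<Longrightarrow> s < x \<and> x < t \<or> t < x \<and> x < s" for x
    by (auto simp: mult_less_0_iff)
  have pos: "(x - s) * (x - t) > 0 \<Longrightarrow> x < s \<and> x < t \<or> s < x \<and> t < x" for x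
    by (auto simp: zero_less_mult_iff)
  show ?thesis
  proof (rule ccontr)
    assume "\<not> ?thesis"
    then consider "(s' - s) * (s' - t) < 0" "(t' - s) * (t' - t) > 0" 
      | "(s' - s) * (s' - t) > 0" "(t' - s) * (t' - t) < 0"
      by (auto simp: not_le mult_less_0_iff)
    then show False
    proof cases
      case 1
      show False
        using neg[OF 1(1)] pos[OF 1(2)] assms[of s t s' t'] assms[of t s s' t'] assms[of t' s' s t] assms[of t' s' t s]
        by auto
    next
      case 2
      show False
        using neg[OF 2(2)] pos[OF 2(1)] assms[of s t t' s'] assms[of t s t' s'] assms[of s' t' s t] assms[of s' t' t s]
        by auto
    qed
  qed
qed

text \<open>The open half-plane below the tangent at the point is unbounded, misses the drawing and has the point
  in its closure.\<close>
lemma tangent_point_frontier: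
  assumes "\<And>z. z \<in> D \<Longrightarrow> Im z \<ge> 2 * r * Re z - r\<^sup>2" "parabola r \<in> D"
  shows "parabola r \<in> frontier (outside D)"
proof -
  define H where "H = {z. (\<i> - 2 * r) \<bullet> z < - r\<^sup>2}"
  have H: "z \<in> H \<longleftrightarrow> Im z < 2 * r * Re z - r\<^sup>2" for z
    by (auto simp: H_def inner_complex_def)
  have "\<i> - 2 * r \<noteq> 0"
    by (simp add: complex_eq_iff)
  then have "parabola r \<in> closure H"
    unfolding H_def by (simp add: closure_halfspace_lt) (simp add: inner_complex_def parabola_def power2_eq_square)
  moreover have "H \<subseteq> outside D"
  proof
    fix z assume "z \<in> H"
    have "connected H"
      unfolding H_def by (intro convex_connected convex_halfspace_lt)
    moreover have "\<not> bounded H"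
    proof
      assume "bounded H"
      then obtain B where B: "\<And>z. z \<in> H \<Longrightarrow> norm z \<le> B"
        by (auto simp: bounded_iff)
      have "- \<bar>B\<bar> - 1 < r\<^sup>2"
        using zero_le_power2[of r] by linarith
      then have "Complex r (- \<bar>B\<bar> - 1) \<in> H"
        by (simp add: H power2_eq_square)
      then show False
        using B abs_Im_le_cmod[of "Complex r (- \<bar>B\<bar> - 1)"] by fastforce
    qed
    moreover have "H \<inter> D = {}"
      using assms(1) H by fastforce
    ultimately have "H \<subseteq> connected_component_set (- D) z"
      using \<open>z \<in> H\<close> by (intro connected_component_maximal) auto
    then have "\<not> bounded (connected_component_set (- D) z)"
      using \<open>\<not> bounded H\<close> bounded_subset by blast
    then show "z \<in> outside D"
      using \<open>z \<in> H\<close> \<open>H \<inter> D = {}\<close> unfolding outside_def by blast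
  qed
  ultimately have "parabola r \<in> closure (outside D)"
    using closure_mono by blast
  moreover have "parabola r \<notin> interior (outside D)"
    using assms(2) interior_subset outside_no_overlap by blast
  ultimately show ?thesis
    by (simp add: frontier_def)
qed

text \<open>The combinatorial criterion for drawing: with its vertices placed along the parabola, a graph whose
  edges do not interleave is drawn without crossings by straight chords, above every tangent.\<close>
lemma outerplanar_if_noncrossing:
  fixes G :: "'v sgraph" and f :: "'v \<Rightarrow> real"
  assumes inj: "inj_on f (vertices G)"
    and two: "\<And>e. e \<in> edges G \<Longrightarrow> \<exists>u\<in>vertices G. \<exists>v\<in>vertices G. u \<noteq> v \<and> e = {u, v}"
    and nc: "\<And>u v w x. {u, w} \<in> edges G \<Longrightarrow> {v, x} \<in> edges G \<Longrightarrow>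
       \<not> (f u < f v \<and> f v < f w \<and> f w < f x)"
  shows "outerplanar G"
proof -
  define p where "p = (\<lambda>v. parabola (f v))"
  (* Min and Max orient each chord without choosing an order of the two ends of the edge. *)
  define \<gamma> where "\<gamma> = (\<lambda>e. linepath (parabola (Min (f ` e))) (parabola (Max (f ` e))))"
  have im: "path_image (\<gamma> {u, v}) = closed_segment (p u) (p v)" for u v
    by (cases "f u \<le> f v") (auto simp: \<gamma>_def p_def max_def min_def closed_segment_commute)
  have ends: "{pathstart (\<gamma> {u, v}), pathfinish (\<gamma> {u, v})} = p ` {u, v}" for u v
    by (cases "f u \<le> f v") (auto simp: \<gamma>_def p_def max_def min_def)
  have inj_p: "inj_on p (vertices G)"
    using inj by (auto simp: p_def inj_on_def)
  have "plane_drawing G p \<gamma>"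
    unfolding plane_drawing_def
  proof (intro conjI ballI impI inj_p)
    fix e assume "e \<in> edges G"
    then obtain u v where uv: "u \<in> vertices G" "v \<in> vertices G" "u \<noteq> v" "e = {u, v}"
      using two by metis
    have "f u \<noteq> f v"
      using uv inj by (auto dest: inj_onD)
    then show "arc (\<gamma> e)"
      by (simp add: uv(4) \<gamma>_def arc_linepath min_def max_def)
    show "{pathstart (\<gamma> e), pathfinish (\<gamma> e)} = p ` e"
      by (simp only: uv(4) ends)
    show "path_image (\<gamma> e) \<inter> p ` vertices G = p ` e"
    proof
      show "path_image (\<gamma> e) \<inter> p ` vertices G \<subseteq> p ` e"
        unfolding uv(4) im p_def by (auto dest: parabola_on_chord)
      show "p ` e \<subseteq> path_image (\<gamma> e) \<inter> p ` vertices G"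
        unfolding uv(4) im using uv by auto
    qed
  next
    fix e e' assume e: "e \<in> edges G" "e' \<in> edges G" "e \<noteq> e'"
    then obtain u v w x where uv: "u \<in> vertices G" "v \<in> vertices G" "u \<noteq> v" "e = {u, v}"
      and wx: "w \<in> vertices G" "x \<in> vertices G" "w \<noteq> x" "e' = {w, x}"
      using two by metis
    have ne: "f w \<noteq> f x"
      using wx inj by (auto dest: inj_onD)
    have fe: "f ` e \<noteq> f ` e'"
      using inj_on_image_eq_iff[OF inj, of e e'] e(3) uv wx by auto
    have nc': "\<not> (f a < f b \<and> f b < f c \<and> f c < f d)" if "{a, c} = e \<and> {b, d} = e' \<or> {a, c} = e' \<and> {b, d} = e" for a b c d
      using nc[of a c b d] e that by metis
    have sgn: "0 \<le> ((f w - f u) * (f w - f v)) * ((f x - f u) * (f x - f v))"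
    proof (rule noncrossing_sign)
      fix a b c d
      assume "{a, c} = {f u, f v} \<and> {b, d} = {f w, f x} \<or> {a, c} = {f w, f x} \<and> {b, d} = {f u, f v}"
      then show "\<not> (a < b \<and> b < c \<and> c < d)"
        using nc'[of u v w x] nc'[of u v x w] nc'[of v u w x] nc'[of v u x w]
          nc'[of w x u v] nc'[of w x v u] nc'[of x w u v] nc'[of x w v u] uv(4) wx(4)
        by (auto simp: doubleton_eq_iff)
    qed
    show "path_image (\<gamma> e) \<inter> path_image (\<gamma> e') \<subseteq> p ` (e \<inter> e')"
    proof
      fix z assume "z \<in> path_image (\<gamma> e) \<inter> path_image (\<gamma> e')"
      then have "z \<in> parabola ` ({f u, f v} \<inter> {f w, f x})"
        using fe sgn ne unfolding uv(4) wx(4) im p_def by (intro chords_meet) auto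
      moreover have "{f u, f v} \<inter> {f w, f x} = f ` (e \<inter> e')"
        using inj_on_image_Int[OF inj, of e e'] uv wx by auto
      ultimately show "z \<in> p ` (e \<inter> e')"
        by (auto simp: p_def)
    qed
  qed
  moreover have "p ` vertices G \<subseteq> frontier (outside (drawing_image G p \<gamma>))"
  proof
    fix z assume "z \<in> p ` vertices G"
    then obtain v where v: "v \<in> vertices G" "z = parabola (f v)"
      by (auto simp: p_def)
    have "parabola (f v) \<in> frontier (outside (drawing_image G p \<gamma>))"
    proof (rule tangent_point_frontier)
      show "parabola (f v) \<in> drawing_image G p \<gamma>"
        using v by (auto simp: drawing_image_def p_def)
    next
      fix z assume "z \<in> drawing_image G p \<gamma>"
      then consider u where "z = p u" | e where "e \<in> edges G" "z \<in> path_image (\<gamma> e)"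
        by (auto simp: drawing_image_def)
      then have "\<exists>s t. z \<in> closed_segment (parabola s) (parabola t)"
      proof cases
        case 2
        then show ?thesis
          by (auto simp: \<gamma>_def)
      qed (auto simp: p_def)
      then show "Im z \<ge> 2 * f v * Re z - (f v)\<^sup>2"
        using chord_above_tangent by blast
    qed
    then show "z \<in> frontier (outside (drawing_image G p \<gamma>))"
      using v by simp
  qed
  ultimately show ?thesis
    unfolding outerplanar_def by blast
qed

section \<open>Line graphs\<close>

lemma vertices_line_graph [simp]: "vertices (line_graph G) = edges G"
  by (simp add: line_graph_def)

lemma edge_line_graph:
  assumes "e \<in> edges G" "f \<in> edges G" "e \<noteq> f" "e \<inter> f \<noteq> {}"
  shows "{e, f} \<in> edges (line_graph G)"
  using assms by (auto simp: line_graph_def)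

text \<open>The edges at one vertex are pairwise adjacent in the line graph, where four of them form a \<open>K\<^sub>4\<close>.\<close>
lemma line_graph_not_outerplanar_if_degree_ge_4:
  assumes "4 \<le> card S" "u \<notin> S" "\<And>v. v \<in> S \<Longrightarrow> {u, v} \<in> edges G"
  shows "\<not> outerplanar (line_graph G)"
proof
  assume "outerplanar (line_graph G)"
  then obtain p \<gamma> where "outerplanar_drawing (line_graph G) p \<gamma>"
    unfolding outerplanar_drawing_exists by blast
  then interpret outerplanar_drawing "line_graph G" p \<gamma> .
  obtain T where "T \<subseteq> S" "card T = 4"
    using assms(1) by (meson obtain_subset_with_card_n)
  then obtain a b c d where T: "T = {a, b, c, d}" "distinct [a, b, c, d]"
    by (auto simp: numeral_eq_Suc card_Suc_eq)
  then have S: "{a, b, c, d} \<subseteq> S"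
    using \<open>T \<subseteq> S\<close> by simp
  have adj: "{{u, x}, {u, y}} \<in> edges (line_graph G)" if "x \<in> S" "y \<in> S" "x \<noteq> y" for x y
    using that assms(2,3) by (intro edge_line_graph) (auto simp: doubleton_eq_iff)
  show False
    using no_K4[of "{u, a}" "{u, b}" "{u, c}" "{u, d}"] S T(2) assms(2,3) adj
    by (auto simp: doubleton_eq_iff)
qed

text \<open>The line graph of \<open>K\<^sub>2\<^sub>,\<^sub>3\<close> is a prism: the three edges at each of the two vertices on the small side form
  a triangle, and edges with the same end on the large side are partners.\<close>
lemma line_graph_not_outerplanar_if_K23:
  assumes "2 \<le> card S" "3 \<le> card T" "S \<inter> T = {}"
    and "\<And>x y. x \<in> S \<Longrightarrow> y \<in> T \<Longrightarrow> {x, y} \<in> edges G"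
  shows "\<not> outerplanar (line_graph G)"
proof
  assume "outerplanar (line_graph G)"
  then obtain p \<gamma> where "outerplanar_drawing (line_graph G) p \<gamma>"
    unfolding outerplanar_drawing_exists by blast
  then interpret outerplanar_drawing "line_graph G" p \<gamma> .
  obtain S' T' where "S' \<subseteq> S" "card S' = 2" "T' \<subseteq> T" "card T' = 3"
    using assms(1,2) by (meson obtain_subset_with_card_n)
  then obtain x y a b c where xy: "x \<in> S" "y \<in> S" "x \<noteq> y"
    and abc: "a \<in> T" "b \<in> T" "c \<in> T" "a \<noteq> b" "a \<noteq> c" "b \<noteq> c"
    by (metis card_2_iff card_3_iff insert_subset)
  have ne: "s \<noteq> t" if "s \<in> S" "t \<in> T" for s t
    using that assms(3) by auto
  have row: "{{s, t}, {s, t'}} \<in> edges (line_graph G)" if "s \<in> S" "t \<in> T" "t' \<in> T" "t \<noteq> t'" for s t t'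
    using that ne assms(4) by (intro edge_line_graph) (auto simp: doubleton_eq_iff)
  have col: "{{s, t}, {s', t}} \<in> edges (line_graph G)" if "s \<in> S" "s' \<in> S" "t \<in> T" "s \<noteq> s'" for s s' t
    using that ne assms(4) by (intro edge_line_graph) (auto simp: doubleton_eq_iff)
  show False
  proof (rule no_prism[of "{x, a}" "{x, b}" "{x, c}" "{y, a}" "{y, b}" "{y, c}"])
    show "distinct [{x, a}, {x, b}, {x, c}, {y, a}, {y, b}, {y, c}]"
      using xy abc ne by (auto simp: doubleton_eq_iff)
    show "{{y, c}, {y, b}} \<in> edges (line_graph G)"
      using row xy abc by auto
  qed (use xy abc row col assms(4) in auto)
qed

text \<open>Listing the edges of \<open>G\<close> is placing the vertices of its line graph along the parabola.  The condition
  rules out interleaving chords, and is vacuous for at most three edges.\<close>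
lemma line_graph_outerplanar_if_list:
  assumes "edges G \<subseteq> set es"
    and nc: "\<And>i j k l. i < j \<Longrightarrow> j < k \<Longrightarrow> k < l \<Longrightarrow> l < length es \<Longrightarrow>
      es ! i \<inter> es ! k = {} \<or> es ! j \<inter> es ! l = {}"
  shows "outerplanar (line_graph G)"
proof -
  define pos where "pos = (\<lambda>e. LEAST i. i < length es \<and> es ! i = e)"
  have pos: "pos e < length es" "es ! pos e = e" if "e \<in> edges G" for e
  proof -
    have "\<exists>i. i < length es \<and> es ! i = e"
      using that assms(1) by (metis in_set_conv_nth subsetD)
    then show "pos e < length es" "es ! pos e = e"
      unfolding pos_def by (metis (mono_tags, lifting) LeastI_ex)+
  qed
  show ?thesis
  proof (rule outerplanar_if_noncrossing[where f = "\<lambda>e. real (pos e)"])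
    show "inj_on (\<lambda>e. real (pos e)) (vertices (line_graph G))"
    proof (rule inj_onI)
      fix d e assume de: "d \<in> vertices (line_graph G)" "e \<in> vertices (line_graph G)"
        and "real (pos d) = real (pos e)"
      then have "pos d = pos e"
        by simp
      then show "d = e"
        using pos(2) de unfolding vertices_line_graph by metis
    qed
    show "\<exists>u\<in>vertices (line_graph G). \<exists>v\<in>vertices (line_graph G). u \<noteq> v \<and> e = {u, v}"
      if "e \<in> edges (line_graph G)" for e
      using that by (auto simp: line_graph_def)
    fix u v w x assume "{u, w} \<in> edges (line_graph G)" "{v, x} \<in> edges (line_graph G)"
    then have "u \<in> edges G" "w \<in> edges G" "u \<inter> w \<noteq> {}" "v \<in> edges G" "x \<in> edges G" "v \<inter> x \<noteq> {}"
      by (auto simp: line_graph_def doubleton_eq_iff)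
    then show "\<not> (real (pos u) < real (pos v) \<and> real (pos v) < real (pos w) \<and> real (pos w) < real (pos x))"
      using nc[of "pos u" "pos v" "pos w" "pos x"] pos by auto
  qed
qed

section \<open>Adjacency in the essential graph\<close>

context cring begin

lemma ideal_ann: 
  assumes "s \<in> carrier R" shows "ideal (ann R s) R"
proof (rule idealI)
  show "subgroup (ann R s) (add_monoid R)"
    using assms by (intro add.subgroupI) (auto simp: ann_def r_minus r_distr a_inv_def[symmetric])
next
  fix a x assume ax: "a \<in> ann R s" "x \<in> carrier R"
  then show "a \<otimes> x \<in> ann R s"
    using assms by (auto simp: ann_def m_assoc[symmetric])
  then show "x \<otimes> a \<in> ann R s"
    using ax by (auto simp: ann_def m_comm)
qed (rule ring_axioms)

lemma nonzero_ideal_element: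
  assumes "ideal J R" "J \<noteq> {\<zero>}"
  obtains j where "j \<in> J" "j \<noteq> \<zero>" "j \<in> carrier R"
  using assms additive_subgroup.zero_closed[OF ideal.axioms(1)[OF assms(1)]] ideal.Icarr[OF assms(1)]
  by blast

text \<open>For \<open>j\<close> in an ideal, \<open>s\<close> annihilates \<open>s j\<close>.  So a nonzero ideal meets the annihilator of \<open>s\<close> in \<open>s j\<close>, or in
  \<open>j\<close> itself when \<open>s j = 0\<close>.\<close>
lemma essential_ann_if_square_zero:
  assumes "s \<in> carrier R" "s \<otimes> s = \<zero>"
  shows "essential_ideal (ann R s) R"
  unfolding essential_ideal_def
proof (intro conjI allI impI)
  fix J assume J: "ideal J R \<and> J \<noteq> {\<zero>}"
  then obtain j where j: "j \<in> J" "j \<noteq> \<zero>" "j \<in> carrier R"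
    using nonzero_ideal_element by metis
  have sj: "s \<otimes> j \<in> J"
    using ideal.I_l_closed[of J R j s] J j assms by simp
  have "s \<otimes> (s \<otimes> j) = \<zero>"
    using assms j by (simp add: m_assoc[symmetric])
  then have "j \<in> ann R s \<inter> J \<or> s \<otimes> j \<in> ann R s \<inter> J \<and> s \<otimes> j \<noteq> \<zero>"
    using j sj assms by (auto simp: ann_def)
  then show "ann R s \<inter> J \<noteq> {\<zero>}"
    using j(2) by blast
qed (use ideal_ann assms in auto)

lemma edge_if_mult_nilpotent:
  assumes "u \<in> nonzero_zero_divisors R" "v \<in> nonzero_zero_divisors R" "u \<noteq> v"
    and "(u \<otimes> v) \<otimes> (u \<otimes> v) = \<zero>"
  shows "{u, v} \<in> edges (essential_graph R)"
  using assms essential_ann_if_square_zero[of "u \<otimes> v"]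
  by (auto simp: essential_graph_def nonzero_zero_divisors_def)

lemma edge_if_mult_zero:
  assumes "u \<in> carrier R" "v \<in> carrier R" "u \<noteq> \<zero>" "v \<noteq> \<zero>" "u \<noteq> v" "u \<otimes> v = \<zero>"
  shows "{u, v} \<in> edges (essential_graph R)"
proof (rule edge_if_mult_nilpotent)
  show "u \<in> nonzero_zero_divisors R" "v \<in> nonzero_zero_divisors R"
    using assms m_comm[of u v] by (auto simp: nonzero_zero_divisors_def)
qed (use assms in auto)

text \<open>An element in the intersection of the ideal generated by \<open>s\<close> with the annihilator of \<open>s\<close> squares to zero.
  Over a reduced ring the essential graph is therefore the zero-divisor graph.\<close>
lemma essential_ann_reduced_iff:
  assumes "\<And>x. x \<in> carrier R \<Longrightarrow> x \<otimes> x = \<zero> \<Longrightarrow> x = \<zero>" "s \<in> carrier R"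
  shows "essential_ideal (ann R s) R \<longleftrightarrow> s = \<zero>"
proof
  assume ess: "essential_ideal (ann R s) R"
  show "s = \<zero>"
  proof (rule ccontr)
    assume "s \<noteq> \<zero>"
    have "s \<in> PIdl s" using cgenideal_self assms(2) by blast
    then have "ann R s \<inter> PIdl s \<noteq> {\<zero>}"
      using ess cgenideal_ideal[OF assms(2)] \<open>s \<noteq> \<zero>\<close> unfolding essential_ideal_def by blast
    moreover have "\<zero> \<in> ann R s \<inter> PIdl s"
      using assms(2) additive_subgroup.zero_closed[OF ideal.axioms(1)[OF cgenideal_ideal[OF assms(2)]]]
      by (simp add: ann_def)
    ultimately obtain t where t: "t \<in> ann R s" "t \<in> PIdl s" "t \<noteq> \<zero>"
      by blast
    then obtain r where r: "r \<in> carrier R" "t = r \<otimes> s"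
      by (auto simp: cgenideal_def)
    have "t \<otimes> t = r \<otimes> (s \<otimes> t)"
      using t(1) r assms(2) by (simp add: m_assoc)
    then have "t \<otimes> t = \<zero>"
      using t(1) r by (simp add: ann_def)
    then show False
      using assms(1)[of t] t by (auto simp: ann_def)
  qed
next
  assume "s = \<zero>"
  then show "essential_ideal (ann R s) R"
    using essential_ann_if_square_zero[of s] by simp
qed

end

section \<open>Idempotents and rings with few elements\<close>

text \<open>For an idempotent \<open>e\<close> this is the ring \<open>e R\<close>, which shares all operations of \<open>R\<close> except the unit.\<close>
definition corner :: "('a, 'b) ring_scheme \<Rightarrow> 'a \<Rightarrow> ('a, 'b) ring_scheme" where
  "corner R e = R\<lparr>carrier := (\<lambda>x. e \<otimes>\<^bsub>R\<^esub> x) ` carrier R, one := e\<rparr>"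

lemma corner_simps [simp]:
  "carrier (corner R e) = (\<lambda>x. e \<otimes>\<^bsub>R\<^esub> x) ` carrier R"
  "one (corner R e) = e" "zero (corner R e) = zero R"
  "mult (corner R e) = mult R" "add (corner R e) = add R"
  by (simp_all add: corner_def)

context cring begin

lemma corner_mem_iff:
  assumes "e \<in> carrier R" "e \<otimes> e = e"
  shows "x \<in> carrier (corner R e) \<longleftrightarrow> x \<in> carrier R \<and> e \<otimes> x = x"
proof -
  have "e \<otimes> (e \<otimes> y) = e \<otimes> y" if "y \<in> carrier R" for y
    using assms that by (simp add: m_assoc[symmetric])
  then show ?thesis
    using assms by (auto simp: image_iff) (metis)+
qed

lemma cring_corner:
  assumes "e \<in> carrier R" "e \<otimes> e = e"
  shows "cring (corner R e)"
proof (intro cringI abelian_groupI comm_monoidI)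
  note mem = corner_mem_iff[OF assms]
  fix x assume x: "x \<in> carrier (corner R e)"
  then have "\<ominus> x \<in> carrier (corner R e)"
    unfolding mem using assms by (simp add: r_minus)
  then show "\<exists>y\<in>carrier (corner R e). y \<oplus>\<^bsub>corner R e\<^esub> x = \<zero>\<^bsub>corner R e\<^esub>"
    using x unfolding mem by (intro bexI[of _ "\<ominus> x"]) (simp_all add: mem l_neg del: corner_simps(1))
qed (use assms in \<open>auto simp: corner_mem_iff[OF assms] r_distr l_distr a_ac m_ac simp del: corner_simps(1)\<close>)

lemma complement_idempotent:
  assumes "e \<in> carrier R" "e \<otimes> e = e"
  defines "f \<equiv> \<one> \<ominus> e"
  shows "f \<in> carrier R" "e \<oplus> f = \<one>" "e \<otimes> f = \<zero>" "f \<otimes> e = \<zero>" "f \<otimes> f = f"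
proof -
  show 1: "f \<in> carrier R"
    using assms by (simp add: f_def)
  have "e \<oplus> (\<one> \<oplus> \<ominus> e) = \<one> \<oplus> (e \<oplus> \<ominus> e)"
    using assms by (intro a_lcomm) auto
  then show sum: "e \<oplus> f = \<one>"
    using assms by (simp add: f_def minus_eq r_neg)
  have "e \<otimes> (\<one> \<oplus> \<ominus> e) = e \<otimes> \<one> \<oplus> e \<otimes> (\<ominus> e)"
    using assms by (intro r_distr) auto
  also have "\<dots> = \<zero>"
    using assms by (simp add: r_minus r_neg)
  finally show 2: "e \<otimes> f = \<zero>"
    by (simp add: f_def minus_eq)
  then show "f \<otimes> e = \<zero>"
    using assms 1 m_comm by metis
  have "f = (e \<oplus> f) \<otimes> f"
    using sum 1 by simp
  also have "\<dots> = f \<otimes> f"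
    using 1 2 assms by (simp add: l_distr)
  finally show "f \<otimes> f = f" by simp
qed

lemma ring_iso_corners:
  assumes "e \<in> carrier R" "e \<otimes> e = e"
  shows "R \<simeq> RDirProd (corner R e) (corner R (\<one> \<ominus> e))"
proof -
  define f where "f = \<one> \<ominus> e"
  note f = complement_idempotent[OF assms, folded f_def]
  define \<phi> where "\<phi> = (\<lambda>x. (e \<otimes> x, f \<otimes> x))"
  have "\<phi> \<in> ring_iso R (RDirProd (corner R e) (corner R f))"
  proof (rule ring_iso_memI)
    fix x y assume x: "x \<in> carrier R" and y: "y \<in> carrier R"
    show "\<phi> x \<in> carrier (RDirProd (corner R e) (corner R f))"
      using x by (auto simp: \<phi>_def RDirProd_carrier)
    have m: "g \<otimes> (x \<otimes> y) = (g \<otimes> x) \<otimes> (g \<otimes> y)" if "g \<in> carrier R" "g \<otimes> g = g" for g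
    proof -
      have "(g \<otimes> x) \<otimes> (g \<otimes> y) = (g \<otimes> g) \<otimes> (x \<otimes> y)"
        using x y that(1) by (simp add: m_ac)
      then show ?thesis using that(2) by simp
    qed
    show "\<phi> (x \<otimes> y) = \<phi> x \<otimes>\<^bsub>RDirProd (corner R e) (corner R f)\<^esub> \<phi> y"
      using m[OF assms] m[OF f(1,5)] by (simp add: \<phi>_def RDirProd_def DirProd_def monoid.defs)
    show "\<phi> (x \<oplus> y) = \<phi> x \<oplus>\<^bsub>RDirProd (corner R e) (corner R f)\<^esub> \<phi> y"
      using x y assms f by (simp add: \<phi>_def RDirProd_def DirProd_def monoid.defs r_distr)
  next
    show "\<phi> \<one> = \<one>\<^bsub>RDirProd (corner R e) (corner R f)\<^esub>"
      using assms f by (simp add: \<phi>_def RDirProd_def DirProd_def monoid.defs)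
  next
    show "bij_betw \<phi> (carrier R) (carrier (RDirProd (corner R e) (corner R f)))"
    proof (rule bij_betw_byWitness[where f' = "\<lambda>(x, y). x \<oplus> y"])
      show "\<forall>x\<in>carrier R. (\<lambda>(x, y). x \<oplus> y) (\<phi> x) = x"
        using assms f(1,2) by (simp add: \<phi>_def l_distr[symmetric])
      show "\<forall>z\<in>carrier (RDirProd (corner R e) (corner R f)). \<phi> ((\<lambda>(x, y). x \<oplus> y) z) = z"
      proof
        fix z assume "z \<in> carrier (RDirProd (corner R e) (corner R f))"
        then obtain x y where z: "z = (x, y)" "x \<in> carrier R" "e \<otimes> x = x" "y \<in> carrier R" "f \<otimes> y = y"
          using corner_mem_iff[OF assms] corner_mem_iff[OF f(1,5)]
          by (auto simp: RDirProd_carrier simp del: corner_simps)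
        have "e \<otimes> y = \<zero>"
          using z(4,5) f(1,3) assms by (metis l_null m_assoc)
        moreover have "f \<otimes> x = \<zero>"
          using z(2,3) f(1,4) assms by (metis l_null m_assoc)
        ultimately show "\<phi> ((\<lambda>(x, y). x \<oplus> y) z) = z"
          using z assms f(1) by (simp add: \<phi>_def r_distr)
      qed
    qed (use assms f in \<open>auto simp: \<phi>_def RDirProd_carrier\<close>)
  qed
  then show ?thesis
    unfolding is_ring_iso_def f_def by auto
qed

text \<open>The additive order of the unit divides the prime cardinality, so the multiples of the unit already
  exhaust the ring.\<close>
lemma ring_iso_residue_ring_prime:
  assumes "prime (card (carrier R))"
  shows "R \<simeq> residue_ring (int (card (carrier R)))"
proof -
  define n where "n = int (card (carrier R))"
  have n: "n > 1" "prime n"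
    using assms prime_gt_1_nat[OF assms] by (auto simp: n_def)
  have fin: "finite (carrier R)"
    using assms by (metis card.infinite not_prime_0)
  define \<phi> :: "int \<Rightarrow> 'a" where "\<phi> = (\<lambda>k. [k] \<cdot> \<one>)"
  have closed: "\<phi> k \<in> carrier R" for k
    by (simp add: \<phi>_def)
  have add: "\<phi> (i + j) = \<phi> i \<oplus> \<phi> j" for i j
    unfolding \<phi>_def by (simp add: add.int_pow_mult)
  have mult: "\<phi> (i * j) = \<phi> i \<otimes> \<phi> j" for i j
    unfolding \<phi>_def by (simp add: add_pow_ldistr_int add.int_pow_pow mult.commute)
  have one: "\<phi> 1 = \<one>"
    unfolding \<phi>_def by simp
  have n0: "\<phi> n = \<zero>"
    using add.pow_order_eq_1[of \<one>] unfolding \<phi>_def n_def 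
    by (simp add: order_def add_pow_int_ge)
  have md: "\<phi> (k mod n) = \<phi> k" for k
  proof -
    have "\<phi> k = \<phi> (n * (k div n) + k mod n)" by simp
    also have "\<dots> = \<phi> (k mod n)"
      unfolding add mult n0 using closed by simp
    finally show ?thesis by simp
  qed
  have ne: "\<one> \<noteq> \<zero>"
  proof
    assume "\<one> = \<zero>"
    then have "carrier R = {\<zero>}" by (rule one_zeroD)
    then show False using n(1) by (simp add: n_def)
  qed
  have inj: "inj_on \<phi> {0..n - 1}"
  proof (rule linorder_inj_onI')
    fix i j :: int assume ij: "i \<in> {0..n - 1}" "j \<in> {0..n - 1}" "i < j"
    show "\<phi> i \<noteq> \<phi> j"
    proof
      assume "\<phi> i = \<phi> j"
      then have "\<phi> i \<oplus> \<phi> (j - i) = \<phi> i \<oplus> \<zero>"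
        using closed add[of i "j - i"] by simp
      then have z: "\<phi> (j - i) = \<zero>"
        using closed by simp
      have "\<not> n dvd j - i"
        using ij zdvd_not_zless[of "j - i" n] by auto
      then have "coprime n (j - i)"
        using n(2) prime_imp_coprime by blast
      then obtain u v where "u * n + v * (j - i) = 1"
        using bezout_int[of n "j - i"] by (metis coprime_iff_gcd_eq_1)
      then have "\<one> = \<phi> (u * n + v * (j - i))"
        using one by simp
      also have "\<dots> = \<zero>"
        unfolding add mult z n0 using closed by simp
      finally show False using ne by simp
    qed
  qed
  have "\<phi> \<in> ring_iso (residue_ring n) R"
  proof (rule ring_iso_memI)
    have "card (\<phi> ` {0..n - 1}) = card (carrier R)"
      using card_image[OF inj] n(1) by (simp add: n_def)
    then have "\<phi> ` {0..n - 1} = carrier R"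
      using closed fin by (intro card_subset_eq) auto
    then show "bij_betw \<phi> (carrier (residue_ring n)) (carrier R)"
      using inj by (simp add: bij_betw_def residue_ring_def)
  qed (use closed md add mult one in \<open>auto simp: residue_ring_def\<close>)
  then have "residue_ring n \<simeq> R"
    unfolding is_ring_iso_def by auto
  moreover interpret res: residues n "residue_ring n"
    using n by unfold_locales auto
  show ?thesis
    using ring_iso_sym[OF res.ring_axioms] calculation unfolding n_def by blast
qed

text \<open>If \<open>1 + 1\<close> is not zero, it squares to \<open>4 = 0\<close>.  Otherwise the ring is \<open>{0, 1, x, 1 + x}\<close> in characteristic two, and
  the four possible values of \<open>x\<^sup>2\<close> are sorted into the three cases: \<open>x\<close> or \<open>1 + x\<close> squares to zero, \<open>x\<close> is idempotent, or
  \<open>x\<close> is a root of the polynomial that defines the field with four elements.\<close>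
lemma four_element_cases:
  assumes "card (carrier R) = 4"
  obtains x where "x \<in> carrier R" "x \<noteq> \<zero>" "x \<otimes> x = \<zero>"
  | e where "e \<in> carrier R" "e \<otimes> e = e" "e \<noteq> \<zero>" "e \<noteq> \<one>"
  | "R \<simeq> GF4"
proof -
  have fin: "finite (carrier R)"
    using assms by (metis card.infinite zero_neq_numeral)
  have ne: "\<one> \<noteq> \<zero>"
  proof
    assume "\<one> = \<zero>"
    then have "carrier R = {\<zero>}" by (rule one_zeroD)
    then show False using assms by simp
  qed
  define t where "t = \<one> \<oplus> \<one>"
  have "[(4::nat)] \<cdot> \<one> = \<zero>"
    using add.pow_order_eq_1[of \<one>] assms by (simp add: order_def)
  then have "t \<otimes> t = \<zero>"
    unfolding t_def by (simp add: numeral_eq_Suc add.nat_pow_Suc r_distr l_distr a_assoc)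
  show ?thesis
  proof (cases "t = \<zero>")
    case False
    then show ?thesis
      using that(1)[of t] \<open>t \<otimes> t = \<zero>\<close> by (simp add: t_def)
  next
    case True
    have double: "y \<oplus> y = \<zero>" if "y \<in> carrier R" for y
    proof -
      have "y \<oplus> y = t \<otimes> y" using that by (simp add: t_def l_distr)
      then show ?thesis using that True by simp
    qed
    have "\<not> carrier R \<subseteq> {\<zero>, \<one>}"
      using assms card_mono[of "{\<zero>, \<one>}" "carrier R"] ne by auto
    then obtain x where x: "x \<in> carrier R" "x \<noteq> \<zero>" "x \<noteq> \<one>"
      by auto
    have cancel: "y \<oplus> (y \<oplus> z) = z" if "y \<in> carrier R" "z \<in> carrier R" for y z
      using that double[of y] by (simp add: a_assoc[symmetric])
    have x1: "\<one> \<oplus> x \<noteq> \<zero>" "\<one> \<oplus> x \<noteq> \<one>" "\<one> \<oplus> x \<noteq> x"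
      using x ne cancel[of \<one> x] cancel[of x \<one>] by (auto simp: a_comm)
    have "card {\<zero>, \<one>, x, \<one> \<oplus> x} = 4"
      using x ne x1 by (auto simp: eq_commute)
    then have carr: "carrier R = {\<zero>, \<one>, x, \<one> \<oplus> x}"
      using assms fin x by (intro card_subset_eq[symmetric]) auto
    have "x \<otimes> x \<in> carrier R" using x by simp
    then consider "x \<otimes> x = \<zero>" | "x \<otimes> x = \<one>" | "x \<otimes> x = x" | "x \<otimes> x = \<one> \<oplus> x"
      unfolding carr by blast
    then show ?thesis
    proof cases
      case 1
      then show ?thesis using that(1) x by blast
    next
      case 2
      then have "(\<one> \<oplus> x) \<otimes> (\<one> \<oplus> x) = \<zero>"
        using x double[of \<one>] double[of x] cancel[of x \<one>] by (simp add: r_distr l_distr a_ac)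
      then show ?thesis using that(1)[of "\<one> \<oplus> x"] x x1 by simp
    next
      case 3
      then show ?thesis using that(2) x by blast
    next
      case 4
      define \<phi> :: "int \<times> int \<Rightarrow> 'a" where
        "\<phi> = (\<lambda>(a, b). (if a = 1 then \<one> else \<zero>) \<oplus> (if b = 1 then x else \<zero>))"
      have "\<phi> \<in> ring_iso GF4 R"
      proof (rule ring_iso_memI)
        show "bij_betw \<phi> (carrier GF4) (carrier R)"
          unfolding bij_betw_def carr using x x1 ne
          by (auto simp: inj_on_def \<phi>_def GF4_def image_iff)
      qed (use 4 x double cancel in \<open>auto simp: \<phi>_def GF4_def r_distr l_distr a_ac\<close>)
      then have "GF4 \<simeq> R" unfolding is_ring_iso_def by auto
      moreover have "ring GF4"
        using field_GF4 by (simp add: field.is_ring)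
      ultimately show ?thesis
        using that(3) ring_iso_sym by blast
    qed
  qed
qed

lemma maximalideal_exists:
  assumes "\<one> \<noteq> \<zero>" "finite (carrier R)"
  obtains M where "maximalideal M R"
proof -
  define S where "S = {I. ideal I R \<and> \<one> \<notin> I}"
  have "finite S"
    using assms(2) ideal.Icarr by (intro finite_subset[of S "Pow (carrier R)"]) (auto simp: S_def)
  moreover have "{\<zero>} \<in> S"
    using assms(1) zeroideal by (simp add: S_def)
  ultimately obtain M where M: "M \<in> S" "\<And>I. I \<in> S \<Longrightarrow> M \<subseteq> I \<Longrightarrow> M = I"
    using finite_has_maximal[of S] by (metis empty_iff)
  have "maximalideal M R"
  proof (rule maximalidealI)
    show "ideal M R" "carrier R \<noteq> M"
      using M(1) by (auto simp: S_def)
  next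
    fix J assume J: "ideal J R" "M \<subseteq> J" "J \<subseteq> carrier R"
    then show "J = M \<or> J = carrier R"
      using M(2)[of J] ideal.one_imp_carrier by (auto simp: S_def)
  qed
  then show ?thesis using that by blast
qed

text \<open>The powers of \<open>x\<close> are eventually periodic, with some period \<open>d\<close> from some exponent \<open>i\<close> on.  The exponent
  \<open>i d\<close> is past \<open>i\<close> and a multiple of the period, so doubling it changes nothing.\<close>
lemma power_idempotent:
  assumes "finite (carrier R)" "x \<in> carrier R"
  obtains k :: nat where "0 < k" "x [^] k \<otimes> x [^] k = x [^] k"
proof -
  have "\<not> inj_on (\<lambda>n::nat. x [^] n) {0<..}"
  proof
    assume "inj_on (\<lambda>n::nat. x [^] n) {0<..}"
    moreover have "finite ((\<lambda>n::nat. x [^] n) ` {0<..})"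
      using assms by (intro finite_subset[OF _ assms(1)]) auto
    ultimately show False
      using finite_imageD infinite_Ioi by blast
  qed
  then have "\<exists>i j::nat. 0 < i \<and> i < j \<and> x [^] i = x [^] j"
    using linorder_inj_onI'[of "{0<..}" "\<lambda>n::nat. x [^] n"] unfolding greaterThan_iff by blast
  then obtain i j :: nat where ij: "0 < i" "i < j" "x [^] i = x [^] j"
    by blast
  define d where "d = j - i"
  have d: "0 < i" "0 < d" "x [^] (i + d) = x [^] i"
    using ij by (simp_all add: d_def)
  have step: "x [^] (n + d) = x [^] n" if "i \<le> n" for n
  proof -
    have "x [^] (n + d) = x [^] (n - i) \<otimes> x [^] (i + d)"
      using that assms(2) by (simp add: nat_pow_mult)
    also have "\<dots> = x [^] n"
      unfolding d(3) using that assms(2) by (simp add: nat_pow_mult)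
    finally show ?thesis .
  qed
  have "x [^] (n + m * d) = x [^] n" if "i \<le> n" for n m
    using that by (induction m) (auto simp: step add.assoc[symmetric] add.commute[of d])
  from this[of "i * d" i] have "x [^] (i * d) \<otimes> x [^] (i * d) = x [^] (i * d)"
    using d assms(2) by (simp add: nat_pow_mult)
  then show ?thesis
    using that[of "i * d"] d by simp
qed

text \<open>Two maximal ideals \<open>M\<close> and \<open>N\<close> give \<open>x \<in> M\<close> with \<open>1 - x \<in> N\<close>.  An idempotent power of \<open>x\<close> is not \<open>1\<close>, since it
  lies in \<open>M\<close>, and not \<open>0\<close>, since then the prime ideal \<open>N\<close> would contain \<open>x\<close> and hence \<open>1\<close>.\<close>
lemma idempotent_if_not_local:
  assumes "\<one> \<noteq> \<zero>" "finite (carrier R)" "\<not> local_ring R"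
  obtains e where "e \<in> carrier R" "e \<otimes> e = e" "e \<noteq> \<zero>" "e \<noteq> \<one>"
proof -
  obtain M where M: "maximalideal M R"
    using maximalideal_exists assms(1,2) by blast
  then obtain N where N: "maximalideal N R" "M \<noteq> N"
    using assms(3) unfolding local_ring_def by blast
  have id: "ideal M R" "ideal N R"
    using M N maximalideal.axioms(1) by auto
  have notone: "\<one> \<notin> M" "\<one> \<notin> N"
    using M N(1) ideal.one_imp_carrier maximalideal.I_notcarr id by metis+
  have "M <+> N = carrier R"
  proof -
    have sum: "ideal (M <+> N) R"
      using add_ideals id by blast
    have "\<zero> \<in> M" "\<zero> \<in> N"
      using id additive_subgroup.zero_closed[OF ideal.axioms(1)] by auto
    moreover have "x = x \<oplus> \<zero>" if "x \<in> M" for x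
      using ideal.Icarr[OF id(1) that] by simp
    moreover have "x = \<zero> \<oplus> x" if "x \<in> N" for x
      using ideal.Icarr[OF id(2) that] by simp
    ultimately have sub: "M \<subseteq> M <+> N" "N \<subseteq> M <+> N"
      unfolding set_add_def' by blast+
    have "M <+> N \<subseteq> carrier R"
      using ideal.Icarr[OF sum] by blast
    then have "M <+> N = M \<or> M <+> N = carrier R" "M <+> N = N \<or> M <+> N = carrier R"
      using maximalideal.I_maximal[OF M sum sub(1)] maximalideal.I_maximal[OF N(1) sum sub(2)]
      by blast+
    then show ?thesis
      using N(2) by metis
  qed
  then obtain x y where xy: "x \<in> M" "y \<in> N" "\<one> = x \<oplus> y"
    using one_closed unfolding set_add_def' by blast
  have x: "x \<in> carrier R" using ideal.Icarr[OF id(1) xy(1)] .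
  obtain k :: nat where k: "0 < k" "x [^] k \<otimes> x [^] k = x [^] k"
    by (rule power_idempotent[OF assms(2) x])
  have "x [^] k \<noteq> \<one>"
  proof -
    have "x [^] k = x [^] (k - 1) \<otimes> x"
      using k(1) x by (cases k) auto
    then have "x [^] k \<in> M"
      using ideal.I_l_closed[OF id(1) xy(1)] x by simp
    then show ?thesis using notone by auto
  qed
  moreover have "x [^] k \<noteq> \<zero>"
  proof
    assume "x [^] k = \<zero>"
    then have "x [^] k \<in> N"
      using additive_subgroup.zero_closed[OF ideal.axioms(1)[OF id(2)]] by simp
    moreover have "x \<in> N" if "x [^] n \<in> N" for n :: nat
      using that
    proof (induction n)
      case (Suc n)
      then show ?case
        using primeideal.I_prime[OF maximalideal_prime[OF N(1)], of "x [^] n" x] x by auto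
    qed (use notone in auto)
    ultimately have "x \<in> N" by blast
    then have "\<one> \<in> N"
      using xy additive_subgroup.a_closed[OF ideal.axioms(1)[OF id(2)]] by simp
    then show False using notone by simp
  qed
  ultimately show ?thesis
    using that[of "x [^] k"] k x by simp
qed

end

section \<open>Rings whose line graph is outerplanar\<close>

context cring begin

lemma not_outerplanar_if_annihilates_4:
  assumes "u \<in> carrier R" "u \<noteq> \<zero>" "u \<notin> S" "4 \<le> card S"
    and "\<And>v. v \<in> S \<Longrightarrow> v \<in> carrier R \<and> v \<noteq> \<zero> \<and> u \<otimes> v = \<zero>"
  shows "\<not> outerplanar (line_graph (essential_graph R))"
  by (rule line_graph_not_outerplanar_if_degree_ge_4[of S u])
    (use assms in \<open>auto intro!: edge_if_mult_zero\<close>)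

text \<open>A nonzero \<open>n\<close> with square zero is adjacent to every other vertex, because the product with any \<open>v\<close> again
  has square zero.  With \<open>f = 1 - e\<close>, the zero-divisors \<open>e\<close>, \<open>f\<close>, \<open>e + n\<close> and \<open>f + n\<close> are four of them; multiplication by
  \<open>n\<close> sends the first and the third to \<open>n\<close>, the other two to \<open>0\<close>.\<close>
lemma not_outerplanar_if_square_zero:
  assumes e: "e \<in> carrier R" "e \<otimes> e = e" "e \<noteq> \<one>"
    and n: "n \<in> carrier R" "n \<otimes> n = \<zero>" "n \<noteq> \<zero>" "e \<otimes> n = n"
  shows "\<not> outerplanar (line_graph (essential_graph R))"
proof -
  define f where "f = \<one> \<ominus> e"
  note f = complement_idempotent[OF e(1,2), folded f_def]
  have "f \<noteq> \<zero>"
    using f(2) e by auto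
  have ne: "n \<otimes> e = n"
    using n e by (simp add: m_comm)
  have nf: "n \<otimes> f = \<zero>"
  proof -
    have "n \<otimes> f = (n \<otimes> e) \<otimes> f"
      using ne by simp
    also have "\<dots> = \<zero>"
      using n(1) e(1) f(1,3) by (simp add: m_assoc)
    finally show ?thesis .
  qed
  have fn: "f \<otimes> n = \<zero>"
    using nf n(1) f(1) by (simp add: m_comm)
  have times_n: "n \<otimes> (e \<oplus> n) = n" "n \<otimes> (f \<oplus> n) = \<zero>"
    using e n f nf ne by (simp_all add: r_distr)
  have times_f: "f \<otimes> (e \<oplus> n) = \<zero>" "f \<otimes> (f \<oplus> n) = f"
    using e n f fn by (simp_all add: r_distr)
  define S where "S = {e, f, e \<oplus> n, f \<oplus> n}"
  have nonzero: "e \<noteq> \<zero>" "e \<oplus> n \<noteq> \<zero>" "f \<oplus> n \<noteq> \<zero>"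
    using ne times_n(1) times_f(2) n(1,3) f(1) \<open>f \<noteq> \<zero>\<close> r_null by metis+
  have "e \<noteq> f" "e \<noteq> f \<oplus> n" "f \<noteq> e \<oplus> n" "e \<oplus> n \<noteq> f \<oplus> n"
    using ne nf times_n n(3) by metis+
  moreover have "e \<oplus> n \<noteq> e" "f \<oplus> n \<noteq> f"
    using e(1) f(1) n(1,3) by simp_all
  ultimately have card: "card S = 4"
    by (auto simp: S_def)
  have "n \<notin> S"
    using ne times_n(1) fn times_f(2) f(5) n(2,3) \<open>f \<noteq> \<zero>\<close> unfolding S_def by (metis empty_iff insert_iff)
  have zd: "v \<in> nonzero_zero_divisors R" if "v \<in> S" for v
  proof -
    have "e \<oplus> n \<in> carrier R \<and> f \<oplus> n \<in> carrier R"
      using e f n by simp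
    moreover have "(e \<oplus> n) \<otimes> f = \<zero>" "(f \<oplus> n) \<otimes> n = \<zero>"
      using times_n times_f e(1) f(1) n(1) m_comm by (metis a_closed)+
    moreover have "x \<in> nonzero_zero_divisors R"
      if "x \<in> carrier R" "x \<noteq> \<zero>" "y \<in> carrier R" "y \<noteq> \<zero>" "x \<otimes> y = \<zero>" for x y
      using that unfolding nonzero_zero_divisors_def by blast
    ultimately have "{e, f, e \<oplus> n, f \<oplus> n} \<subseteq> nonzero_zero_divisors R"
      using e(1) f(1,3,4) n(1,3) nonzero \<open>f \<noteq> \<zero>\<close> by (metis empty_subsetI insert_subset)
    then show ?thesis
      using that unfolding S_def by blast
  qed
  have zn: "n \<in> nonzero_zero_divisors R"
    using n(1-3) unfolding nonzero_zero_divisors_def by blast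
  show ?thesis
  proof (rule line_graph_not_outerplanar_if_degree_ge_4[of S n])
    fix v assume v: "v \<in> S"
    have "v \<in> carrier R"
      using zd[OF v] by (simp add: nonzero_zero_divisors_def)
    then have "(n \<otimes> v) \<otimes> (n \<otimes> v) = (n \<otimes> n) \<otimes> (v \<otimes> v)"
      using n(1) by (simp add: m_ac)
    then have "(n \<otimes> v) \<otimes> (n \<otimes> v) = \<zero>"
      using n \<open>v \<in> carrier R\<close> by simp
    then show "{n, v} \<in> edges (essential_graph R)"
      using zn zd[OF v] v \<open>n \<notin> S\<close> by (intro edge_if_mult_nilpotent) auto
  qed (use card \<open>n \<notin> S\<close> in auto)
qed

lemma corner_card_ge_2:
  assumes "finite (carrier R)" "e \<in> carrier R" "e \<otimes> e = e" "e \<noteq> \<zero>"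
  shows "2 \<le> card (carrier (corner R e))"
proof -
  have "{\<zero>, e} \<subseteq> carrier (corner R e)"
    unfolding corner_mem_iff[OF assms(2,3)] subset_iff using assms(2,3) by auto
  moreover have "finite (carrier (corner R e))"
    using assms(1) by simp
  ultimately have "card {\<zero>, e} \<le> card (carrier (corner R e))"
    by (rule card_mono[rotated])
  then show ?thesis
    using assms(4) by simp
qed

text \<open>Nonzero elements of \<open>e R\<close> are adjacent to nonzero elements of \<open>f R\<close>, so the essential graph contains a
  complete bipartite graph.  Its sides are one smaller than the corners.\<close>
lemma corner_card_bounds:
  assumes fin: "finite (carrier R)"
    and e: "e \<in> carrier R" "e \<otimes> e = e" "e \<noteq> \<zero>"
    and f: "f \<in> carrier R" "f \<otimes> f = f" "f \<noteq> \<zero>" and ef: "e \<otimes> f = \<zero>"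
    and outer: "outerplanar (line_graph (essential_graph R))"
  shows "card (carrier (corner R f)) \<le> 4"
    and "\<not> (3 \<le> card (carrier (corner R e)) \<and> 4 \<le> card (carrier (corner R f)))"
proof -
  define S where "S = carrier (corner R e) - {\<zero>}"
  define T where "T = carrier (corner R f) - {\<zero>}"
  have zero: "\<zero> \<in> carrier (corner R e)" "\<zero> \<in> carrier (corner R f)"
    unfolding corner_mem_iff[OF e(1,2)] corner_mem_iff[OF f(1,2)] using e f by simp_all
  have card: "card S = card (carrier (corner R e)) - 1" "card T = card (carrier (corner R f)) - 1"
    unfolding S_def T_def using zero fin by (simp_all add: card_Diff_singleton del: corner_simps(1)) 
  have S: "x \<in> carrier R \<and> x \<noteq> \<zero> \<and> e \<otimes> x = x" if "x \<in> S" for x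
    using that unfolding S_def corner_mem_iff[OF e(1,2)] Diff_iff by auto
  have T: "x \<in> carrier R \<and> x \<noteq> \<zero> \<and> f \<otimes> x = x" if "x \<in> T" for x
    using that unfolding T_def corner_mem_iff[OF f(1,2)] Diff_iff by auto
  have ann: "e \<otimes> y = \<zero>" if "y \<in> T" for y
  proof -
    have "e \<otimes> y = (e \<otimes> f) \<otimes> y"
      using T[OF that] e(1) f(1) by (simp add: m_assoc)
    then show ?thesis using T[OF that] ef by simp
  qed
  have prod: "x \<otimes> y = \<zero>" if "x \<in> S" "y \<in> T" for x y
  proof -
    have "x \<otimes> y = x \<otimes> (e \<otimes> y)"
      using S[OF that(1)] T[OF that(2)] e(1) by (metis m_assoc m_comm)
    then show ?thesis using S[OF that(1)] ann[OF that(2)] by simp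
  qed
  have disj: "S \<inter> T = {}"
    using S ann by fastforce
  have "e \<in> S"
    unfolding S_def Diff_iff corner_mem_iff[OF e(1,2)] using e by simp
  show "card (carrier (corner R f)) \<le> 4"
  proof (rule ccontr)
    assume "\<not> ?thesis"
    then have "4 \<le> card T" using card by simp
    then show False
      using not_outerplanar_if_annihilates_4[of e T] e(1,3) T ann disj \<open>e \<in> S\<close> outer by blast
  qed
  show "\<not> (3 \<le> card (carrier (corner R e)) \<and> 4 \<le> card (carrier (corner R f)))"
  proof
    assume "3 \<le> card (carrier (corner R e)) \<and> 4 \<le> card (carrier (corner R f))"
    then have "2 \<le> card S" "3 \<le> card T" using card by linarith+
    moreover have "{x, y} \<in> edges (essential_graph R)" if "x \<in> S" "y \<in> T" for x y
      using that S T prod disj by (intro edge_if_mult_zero) auto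
    ultimately show False
      using line_graph_not_outerplanar_if_K23[OF _ _ disj] outer by blast
  qed
qed

end

lemma RDirProd_cong:
  assumes "R \<simeq> R'" "S \<simeq> S'"
  shows "RDirProd R S \<simeq> RDirProd R' S'"
  using assms RDirProd_iso6 unfolding is_ring_iso_def by blast

lemma (in cring) ring_iso_product_if_idempotent_of_card_4:
  assumes "card (carrier R) = 4" "e \<in> carrier R" "e \<otimes> e = e" "e \<noteq> \<zero>" "e \<noteq> \<one>"
  shows "R \<simeq> RDirProd (residue_ring 2) (residue_ring 2)"
proof -
  define f where "f = \<one> \<ominus> e"
  note f = complement_idempotent[OF assms(2,3), folded f_def]
  interpret E: cring "corner R e" using cring_corner assms by blast
  interpret F: cring "corner R f" using cring_corner f by blast
  have fin: "finite (carrier R)"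
    using assms(1) by (metis card.infinite zero_neq_numeral)
  have "f \<noteq> \<zero>" using f(2) assms by auto
  have iso: "R \<simeq> RDirProd (corner R e) (corner R f)"
    using ring_iso_corners assms(2,3) unfolding f_def by blast
  have "card (carrier (corner R e)) * card (carrier (corner R f)) = 4"
    using ring_iso_same_card[OF iso] assms(1) by (simp add: RDirProd_carrier card_cartesian_product del: corner_simps)
  moreover have "2 \<le> card (carrier (corner R e))" "2 \<le> card (carrier (corner R f))"
    using corner_card_ge_2[OF fin] assms f \<open>f \<noteq> \<zero>\<close> by blast+
  moreover have "a = 2 \<and> b = 2" if "a * b = 4" "2 \<le> a" "2 \<le> b" for a b :: nat
    using that mult_le_mono[of 3 a 2 b] mult_le_mono[of 2 a 3 b] by linarith
  ultimately have "card (carrier (corner R e)) = 2" "card (carrier (corner R f)) = 2"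
    by blast+
  then have "corner R e \<simeq> residue_ring 2" "corner R f \<simeq> residue_ring 2"
    using E.ring_iso_residue_ring_prime F.ring_iso_residue_ring_prime by (simp_all del: corner_simps)
  then show ?thesis
    using ring_iso_trans[OF iso RDirProd_cong] by blast
qed

text \<open>The bounds leave the cardinalities \<open>2 \<times> 2\<close>, \<open>2 \<times> 3\<close>, \<open>3 \<times> 3\<close> and \<open>2 \<times> 4\<close> for the two factors.  Only a factor of
  four elements is not determined by its cardinality: it is the field, or splits once more, or has an element of
  square zero, which is excluded.\<close>
lemma (in cring) classification_if_outerplanar_le:
  assumes fin: "finite (carrier R)"
    and e: "e \<in> carrier R" "e \<otimes> e = e" "e \<noteq> \<zero>" "e \<noteq> \<one>"
    and outer: "outerplanar (line_graph (essential_graph R))"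
    and le: "card (carrier (corner R e)) \<le> card (carrier (corner R (\<one> \<ominus> e)))"
  shows "R \<simeq> RDirProd (residue_ring 2) (residue_ring 2) \<or>
      R \<simeq> RDirProd (residue_ring 2) (residue_ring 3) \<or>
      R \<simeq> RDirProd (residue_ring 3) (residue_ring 3) \<or>
      R \<simeq> RDirProd (residue_ring 2) GF4 \<or>
      R \<simeq> RDirProd (residue_ring 2) (RDirProd (residue_ring 2) (residue_ring 2))"
proof -
  define f where "f = \<one> \<ominus> e"
  note f = complement_idempotent[OF e(1,2), folded f_def]
  define m where "m = card (carrier (corner R e))"
  define n where "n = card (carrier (corner R f))"
  interpret E: cring "corner R e" using cring_corner e by blast
  interpret F: cring "corner R f" using cring_corner f by blast
  have "f \<noteq> \<zero>" using f(2) e by auto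
  have "f \<noteq> \<one>" using f(3) e by auto
  have iso: "R \<simeq> RDirProd (corner R e) (corner R f)"
    using ring_iso_corners e(1,2) unfolding f_def by blast
  note iso' = ring_iso_trans[OF iso RDirProd_cong]
  have "2 \<le> m" "m \<le> n" "n \<le> 4" "\<not> (3 \<le> m \<and> 4 \<le> n)"
    using corner_card_ge_2[OF fin e(1-3)] le corner_card_bounds[OF fin e(1-3) f(1,5) \<open>f \<noteq> \<zero>\<close> f(3) outer]
    unfolding m_def n_def f_def by auto
  then consider "m = 2" "n = 2" | "m = 2" "n = 3" | "m = 3" "n = 3" | "m = 2" "n = 4"
    by linarith
  then show ?thesis
  proof cases
    case 1
    then have "corner R e \<simeq> residue_ring 2" "corner R f \<simeq> residue_ring 2"
      using E.ring_iso_residue_ring_prime F.ring_iso_residue_ring_prime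
      by (simp_all add: m_def n_def del: corner_simps)
    then show ?thesis
      using iso' by blast
  next
    case 2
    then have "corner R e \<simeq> residue_ring 2" "corner R f \<simeq> residue_ring 3"
      using E.ring_iso_residue_ring_prime F.ring_iso_residue_ring_prime
      by (simp_all add: m_def n_def del: corner_simps)
    then show ?thesis
      using iso' by blast
  next
    case 3
    then have "corner R e \<simeq> residue_ring 3" "corner R f \<simeq> residue_ring 3"
      using E.ring_iso_residue_ring_prime F.ring_iso_residue_ring_prime
      by (simp_all add: m_def n_def del: corner_simps)
    then show ?thesis
      using iso' by blast
  next
    case 4
    have E: "corner R e \<simeq> residue_ring 2"
      using 4 E.ring_iso_residue_ring_prime by (simp add: m_def del: corner_simps)
    have "card (carrier (corner R f)) = 4"
      using 4 by (simp add: n_def del: corner_simps)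
    then show ?thesis
    proof (cases rule: F.four_element_cases)
      case (1 x)
      then have "x \<in> carrier R" "f \<otimes> x = x" "x \<otimes> x = \<zero>" "x \<noteq> \<zero>"
        using corner_mem_iff[OF f(1,5)] by (auto simp del: corner_simps(1))
      then show ?thesis
        using not_outerplanar_if_square_zero[OF f(1,5) \<open>f \<noteq> \<one>\<close>] outer by blast
    next
      case (2 g)
      then show ?thesis
        using F.ring_iso_product_if_idempotent_of_card_4 \<open>card (carrier (corner R f)) = 4\<close> iso'[OF E]
        by blast
    next
      case 3
      then show ?thesis using iso'[OF E] by blast
    qed
  qed
qed

lemma (in cring) classification_if_outerplanar:
  assumes "\<one> \<noteq> \<zero>" and fin: "finite (carrier R)" and "\<not> local_ring R"
    and outer: "outerplanar (line_graph (essential_graph R))"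
  shows "R \<simeq> RDirProd (residue_ring 2) (residue_ring 2) \<or>
      R \<simeq> RDirProd (residue_ring 2) (residue_ring 3) \<or>
      R \<simeq> RDirProd (residue_ring 3) (residue_ring 3) \<or>
      R \<simeq> RDirProd (residue_ring 2) GF4 \<or>
      R \<simeq> RDirProd (residue_ring 2) (RDirProd (residue_ring 2) (residue_ring 2))"
proof -
  obtain e where e: "e \<in> carrier R" "e \<otimes> e = e" "e \<noteq> \<zero>" "e \<noteq> \<one>"
    by (rule idempotent_if_not_local[OF assms(1-3)])
  define f where "f = \<one> \<ominus> e"
  note f = complement_idempotent[OF e(1,2), folded f_def]
  have "f \<noteq> \<zero>" using f(2) e by auto
  have "f \<noteq> \<one>" using f(3) e by auto
  have "f \<oplus> e = f \<oplus> (\<one> \<ominus> f)"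
    using f(2) complement_idempotent(2)[OF f(1,5)] e(1) f(1) a_comm by metis
  then have "\<one> \<ominus> f = e"
    using e(1) f(1) by simp
  then show ?thesis
    using classification_if_outerplanar_le[OF fin e outer]
      classification_if_outerplanar_le[OF fin f(1,5) \<open>f \<noteq> \<zero>\<close> \<open>f \<noteq> \<one>\<close> outer]
    unfolding f_def[symmetric] by (metis nle_le)
qed

section \<open>Drawings for the five rings\<close>

definition reduced :: "('a, 'b) ring_scheme \<Rightarrow> bool" where
  "reduced R \<longleftrightarrow> (\<forall>x\<in>carrier R. x \<otimes>\<^bsub>R\<^esub> x = \<zero>\<^bsub>R\<^esub> \<longrightarrow> x = \<zero>\<^bsub>R\<^esub>)"

definition zero_product_pairs :: "('a, 'b) ring_scheme \<Rightarrow> 'a set set" where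
  "zero_product_pairs R = {{u, v} | u v. u \<in> carrier R \<and> v \<in> carrier R \<and>
     u \<noteq> \<zero>\<^bsub>R\<^esub> \<and> v \<noteq> \<zero>\<^bsub>R\<^esub> \<and> u \<otimes>\<^bsub>R\<^esub> v = \<zero>\<^bsub>R\<^esub>}"

lemma (in cring) edges_essential_graph_reduced:
  assumes "reduced R"
  shows "edges (essential_graph R) \<subseteq> zero_product_pairs R"
proof
  fix x assume "x \<in> edges (essential_graph R)"
  then obtain u v where x: "x = {u, v}" "u \<in> nonzero_zero_divisors R" "v \<in> nonzero_zero_divisors R"
      "essential_ideal (ann R (u \<otimes> v)) R"
    by (auto simp: essential_graph_def)
  then have uv: "u \<in> carrier R" "v \<in> carrier R" "u \<noteq> \<zero>" "v \<noteq> \<zero>"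
    by (auto simp: nonzero_zero_divisors_def)
  then have "u \<otimes> v = \<zero>"
    using essential_ann_reduced_iff[of "u \<otimes> v"] assms x(4) unfolding reduced_def by blast
  then show "x \<in> zero_product_pairs R"
    using x(1) uv unfolding zero_product_pairs_def by blast
qed

text \<open>The vertices of the line graph are listed in the isomorphic ring, where they can be written down
  explicitly, and carried back along the inverse isomorphism.\<close>
lemma (in cring) outerplanar_if_iso_reduced:
  assumes iso: "R \<simeq> S" and "ring S" and "reduced S"
    and es: "zero_product_pairs S \<subseteq> set es" "\<And>e. e \<in> set es \<Longrightarrow> e \<subseteq> carrier S"
    and nc: "\<And>i j k l. i < j \<Longrightarrow> j < k \<Longrightarrow> k < l \<Longrightarrow> l < length es \<Longrightarrow>
      es ! i \<inter> es ! k = {} \<or> es ! j \<inter> es ! l = {}"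
  shows "outerplanar (line_graph (essential_graph R))"
proof -
  obtain h where h: "h \<in> ring_hom R S" and bij: "bij_betw h (carrier R) (carrier S)"
    using iso unfolding is_ring_iso_def ring_iso_def by auto
  have h0: "h \<zero> = \<zero>\<^bsub>S\<^esub>"
    using ring_hom_zero[OF h ring_axioms \<open>ring S\<close>] .
  have h_eq_0: "h x = \<zero>\<^bsub>S\<^esub> \<longleftrightarrow> x = \<zero>" if "x \<in> carrier R" for x
    using inj_onD[OF bij_betw_imp_inj_on[OF bij], of x \<zero>] h0 that by auto
  have "reduced R"
    unfolding reduced_def
  proof (intro ballI impI)
    fix x assume x: "x \<in> carrier R" "x \<otimes> x = \<zero>"
    then have "h x \<otimes>\<^bsub>S\<^esub> h x = \<zero>\<^bsub>S\<^esub>"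
      using ring_hom_mult[OF h x(1) x(1)] h0 by simp
    then show "x = \<zero>"
      using \<open>reduced S\<close> ring_hom_closed[OF h x(1)] h_eq_0[OF x(1)] unfolding reduced_def by blast
  qed
  define k where "k = inv_into (carrier R) h"
  have inj_k: "inj_on k (carrier S)"
    unfolding k_def using bij by (metis bij_betw_imp_surj_on inj_on_inv_into subset_refl)
  show ?thesis
  proof (rule line_graph_outerplanar_if_list[of _ "map (image k) es"])
    show "edges (essential_graph R) \<subseteq> set (map ((`) k) es)"
    proof
      fix x assume "x \<in> edges (essential_graph R)"
      then obtain u v where x: "x = {u, v}" and uv: "u \<in> carrier R" "v \<in> carrier R" "u \<noteq> \<zero>" "v \<noteq> \<zero>" "u \<otimes> v = \<zero>"
        using edges_essential_graph_reduced[OF \<open>reduced R\<close>] unfolding zero_product_pairs_def by blast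
      have "h u \<otimes>\<^bsub>S\<^esub> h v = \<zero>\<^bsub>S\<^esub>"
        using ring_hom_mult[OF h uv(1,2)] uv(5) h0 by simp
      then have "{h u, h v} \<in> zero_product_pairs S"
        using ring_hom_closed[OF h] h_eq_0 uv unfolding zero_product_pairs_def by blast
      moreover have "x = k ` {h u, h v}"
        using bij_betw_inv_into_left[OF bij] uv x by (simp add: k_def)
      ultimately have "x \<in> image k ` set es"
        using es(1) by blast
      then show "x \<in> set (map ((`) k) es)"
        by simp
    qed
    fix i j m l assume ijml: "i < j" "j < m" "m < l" "l < length (map ((`) k) es)"
    have disj: "k ` (es ! a) \<inter> k ` (es ! b) = {}" if "es ! a \<inter> es ! b = {}" "a < length es" "b < length es" for a b
      using inj_on_image_Int[OF inj_k es(2) es(2), of "es ! a" "es ! b"] that by simp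
    have "es ! i \<inter> es ! m = {} \<or> es ! j \<inter> es ! l = {}"
      using nc ijml by simp
    then show "map ((`) k) es ! i \<inter> map ((`) k) es ! m = {} \<or> map ((`) k) es ! j \<inter> map ((`) k) es ! l = {}"
      using disj[of i m] disj[of j l] ijml by auto
  qed
qed

lemma RDirProd_simps:
  "(a, b) \<otimes>\<^bsub>RDirProd R S\<^esub> (c, d) = (a \<otimes>\<^bsub>R\<^esub> c, b \<otimes>\<^bsub>S\<^esub> d)"
  "\<zero>\<^bsub>RDirProd R S\<^esub> = (\<zero>\<^bsub>R\<^esub>, \<zero>\<^bsub>S\<^esub>)"
  by (simp_all add: RDirProd_def DirProd_def monoid.defs)

lemma reduced_domain: "domain R \<Longrightarrow> reduced R"
  using domain.integral unfolding reduced_def by fastforce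

lemma reduced_RDirProd: "reduced R \<Longrightarrow> reduced S \<Longrightarrow> reduced (RDirProd R S)"
  by (auto simp: reduced_def RDirProd_carrier RDirProd_simps)

lemma zero_product_pairs_RDirProd_domains:
  assumes "domain R" "domain S"
  shows "zero_product_pairs (RDirProd R S) \<subseteq>
    (\<lambda>(x, y). {(x, \<zero>\<^bsub>S\<^esub>), (\<zero>\<^bsub>R\<^esub>, y)}) ` ((carrier R - {\<zero>\<^bsub>R\<^esub>}) \<times> (carrier S - {\<zero>\<^bsub>S\<^esub>}))"
proof
  fix e assume "e \<in> zero_product_pairs (RDirProd R S)"
  then obtain a b c d where e: "e = {(a, b), (c, d)}"
    and mem: "a \<in> carrier R" "c \<in> carrier R" "b \<in> carrier S" "d \<in> carrier S"
    and nz: "a \<noteq> \<zero>\<^bsub>R\<^esub> \<or> b \<noteq> \<zero>\<^bsub>S\<^esub>" "c \<noteq> \<zero>\<^bsub>R\<^esub> \<or> d \<noteq> \<zero>\<^bsub>S\<^esub>"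
    and "a \<otimes>\<^bsub>R\<^esub> c = \<zero>\<^bsub>R\<^esub>" "b \<otimes>\<^bsub>S\<^esub> d = \<zero>\<^bsub>S\<^esub>"
    by (auto simp: zero_product_pairs_def RDirProd_carrier RDirProd_simps)
  then have "a = \<zero>\<^bsub>R\<^esub> \<or> c = \<zero>\<^bsub>R\<^esub>" "b = \<zero>\<^bsub>S\<^esub> \<or> d = \<zero>\<^bsub>S\<^esub>"
    using domain.integral[OF assms(1), of a c] domain.integral[OF assms(2), of b d] by auto
  then consider "b = \<zero>\<^bsub>S\<^esub>" "c = \<zero>\<^bsub>R\<^esub>" "a \<noteq> \<zero>\<^bsub>R\<^esub>" "d \<noteq> \<zero>\<^bsub>S\<^esub>" | "a = \<zero>\<^bsub>R\<^esub>" "d = \<zero>\<^bsub>S\<^esub>" "b \<noteq> \<zero>\<^bsub>S\<^esub>" "c \<noteq> \<zero>\<^bsub>R\<^esub>"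
    using nz by auto
  then show "e \<in> (\<lambda>(x, y). {(x, \<zero>\<^bsub>S\<^esub>), (\<zero>\<^bsub>R\<^esub>, y)}) ` ((carrier R - {\<zero>\<^bsub>R\<^esub>}) \<times> (carrier S - {\<zero>\<^bsub>S\<^esub>}))"
  proof cases
    case 1
    then show ?thesis
      using e mem by (intro image_eqI[of _ _ "(a, d)"]) auto
  next
    case 2
    then show ?thesis
      using e mem by (intro image_eqI[of _ _ "(c, b)"]) auto
  qed
qed

lemma domain_residue_ring: "prime p \<Longrightarrow> domain (residue_ring (int p))"
  using residues_prime.is_field[of p] field.axioms(1) by (auto simp: residues_prime_def)

lemma residue_ring_2: "carrier (residue_ring 2) = {0, 1}" 
  and residue_ring_3: "carrier (residue_ring 3) = {0, 1, 2}"
  and residue_ring_zero: "\<zero>\<^bsub>residue_ring m\<^esub> = 0"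
  and residue_ring_mult: "a \<otimes>\<^bsub>residue_ring m\<^esub> b = a * b mod m"
  by (auto simp: residue_ring_def)

lemma small_residue_rings:
  "domain (residue_ring 2)" "domain (residue_ring 3)" "domain GF4"
  using domain_residue_ring[of 2] domain_residue_ring[of 3] field_GF4 field.axioms(1) by auto

text \<open>For a product of two domains the essential graph is complete bipartite.  Four edges are admitted
  only for \<open>K\<^sub>2\<^sub>,\<^sub>2\<close>, whose line graph is a four-cycle that the list has to follow.\<close>
lemma (in cring) outerplanar_if_iso_product_of_domains:
  assumes iso: "R \<simeq> RDirProd S T" and dom: "domain S" "domain T"
    and es: "(\<lambda>(x, y). {(x, \<zero>\<^bsub>T\<^esub>), (\<zero>\<^bsub>S\<^esub>, y)}) ` ((carrier S - {\<zero>\<^bsub>S\<^esub>}) \<times> (carrier T - {\<zero>\<^bsub>T\<^esub>})) = set es"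
    and len: "length es \<le> 3 \<or> length es = 4 \<and> es ! 0 \<inter> es ! 2 = {}"
  shows "outerplanar (line_graph (essential_graph R))"
proof (rule outerplanar_if_iso_reduced[OF iso])
  interpret S: domain S by fact
  interpret T: domain T by fact
  show "ring (RDirProd S T)"
    by (intro RDirProd_ring S.ring_axioms T.ring_axioms)
  show "reduced (RDirProd S T)"
    by (intro reduced_RDirProd reduced_domain dom)
  show "zero_product_pairs (RDirProd S T) \<subseteq> set es"
    using zero_product_pairs_RDirProd_domains[OF dom] es by simp
  show "e \<subseteq> carrier (RDirProd S T)" if "e \<in> set es" for e
    using that unfolding es[symmetric] by (auto simp: RDirProd_carrier)
  fix i j k l assume ijkl: "i < j" "j < k" "k < l" "l < length es"
  then have "length es = 4 \<and> es ! 0 \<inter> es ! 2 = {}"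
    using len by auto
  moreover from this ijkl have "i = 0" "k = 2"
    by linarith+
  ultimately show "es ! i \<inter> es ! k = {} \<or> es ! j \<inter> es ! l = {}"
    by simp
qed

text \<open>The essential graph is a triangle on the unit vectors with a pendant edge at each corner.  Its line graph
  is the hexagon \<open>es\<close>, in which triangle edges and pendant edges alternate, with a triangle inscribed.\<close>
lemma (in cring) outerplanar_if_iso_Z2_cubed:
  assumes "R \<simeq> RDirProd (residue_ring 2) (RDirProd (residue_ring 2) (residue_ring 2))"
  shows "outerplanar (line_graph (essential_graph R))"
proof (rule outerplanar_if_iso_reduced[OF assms])
  let ?Z = "residue_ring 2" and ?B = "RDirProd (residue_ring 2) (RDirProd (residue_ring 2) (residue_ring 2))"
  define es :: "(int \<times> int \<times> int) set list" where
    "es = [{(1,0,0), (0,1,0)}, {(0,1,0), (1,0,1)}, {(0,1,0), (0,0,1)}, 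
      {(0,0,1), (1,1,0)}, {(0,0,1), (1,0,0)}, {(1,0,0), (0,1,1)}]"
  interpret Z: domain ?Z by (rule small_residue_rings)
  show "ring ?B"
    by (intro RDirProd_ring Z.ring_axioms)
  show "reduced ?B"
    by (intro reduced_RDirProd reduced_domain small_residue_rings)
  show "zero_product_pairs ?B \<subseteq> set es"
  proof
    fix e assume "e \<in> zero_product_pairs ?B"
    then obtain a b c a' b' c' where e: "e = {(a, b, c), (a', b', c')}"
      and mem: "a = 0 \<or> a = 1" "b = 0 \<or> b = 1" "c = 0 \<or> c = 1" "a' = 0 \<or> a' = 1" "b' = 0 \<or> b' = 1" "c' = 0 \<or> c' = 1"
      and nz: "(a, b, c) \<noteq> (0, 0, 0)" "(a', b', c') \<noteq> (0, 0, 0)"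
      and prod: "a * a' mod 2 = 0" "b * b' mod 2 = 0" "c * c' mod 2 = 0"
      unfolding zero_product_pairs_def RDirProd_carrier residue_ring_2 RDirProd_simps(2) residue_ring_zero
      by (elim CollectE exE conjE)
        (simp only: mem_Times_iff insert_iff empty_iff split_paired_all fst_conv snd_conv
          RDirProd_simps(1) residue_ring_mult prod.inject simp_thms)
    have "a = 0 \<or> a' = 0" "b = 0 \<or> b' = 0" "c = 0 \<or> c' = 0"
      using mem prod by auto
    then show "e \<in> set es"
      using mem nz unfolding e
      by (elim disjE) (simp_all add: es_def doubleton_eq_iff)
  qed
  show "e \<subseteq> carrier ?B" if "e \<in> set es" for e
    using that unfolding RDirProd_carrier residue_ring_2 es_def by auto
  fix i j k l assume ijkl: "i < j" "j < k" "k < l" "l < length es"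
  have "length es = 6"
    by (simp add: es_def)
  then have "l = 3 \<or> l = 4 \<or> l = 5" "k = 2 \<or> k = 3 \<or> k = 4" "j = 1 \<or> j = 2 \<or> j = 3" "i = 0 \<or> i = 1 \<or> i = 2"
    using ijkl by linarith+
  then show "es ! i \<inter> es ! k = {} \<or> es ! j \<inter> es ! l = {}"
    using ijkl(1-3) by (elim disjE) (simp_all add: es_def)
qed

lemma (in cring) outerplanar_if_classified:
  assumes "R \<simeq> RDirProd (residue_ring 2) (residue_ring 2) \<or>
      R \<simeq> RDirProd (residue_ring 2) (residue_ring 3) \<or>
      R \<simeq> RDirProd (residue_ring 3) (residue_ring 3) \<or>
      R \<simeq> RDirProd (residue_ring 2) GF4 \<or>
      R \<simeq> RDirProd (residue_ring 2) (RDirProd (residue_ring 2) (residue_ring 2))"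
  shows "outerplanar (line_graph (essential_graph R))"
proof -
  note prod = outerplanar_if_iso_product_of_domains
  have simps: "{0, 1} - {0} = {1::int}" "{0, 1, 2} - {0} = {1, 2::int}"
    "{0, 1} \<times> {0, 1} - {(0, 0)} = {(0, 1), (1, 0), (1, 1 :: int) :: int \<times> int}"
    by auto
  consider "R \<simeq> RDirProd (residue_ring 2) (residue_ring 2)"
    | "R \<simeq> RDirProd (residue_ring 2) (residue_ring 3)"
    | "R \<simeq> RDirProd (residue_ring 3) (residue_ring 3)"
    | "R \<simeq> RDirProd (residue_ring 2) GF4"
    | "R \<simeq> RDirProd (residue_ring 2) (RDirProd (residue_ring 2) (residue_ring 2))"
    using assms by blast
  then show ?thesis
  proof cases
    case 1
    then show ?thesis
      by (rule prod[where es = "[{(1, 0), (0, 1)}]"])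
        (simp_all add: small_residue_rings residue_ring_2 residue_ring_zero simps)
  next
    case 2
    then show ?thesis
      by (rule prod[where es = "[{(1, 0), (0, 1)}, {(1, 0), (0, 2)}]"])
        (simp_all add: small_residue_rings residue_ring_2 residue_ring_3 residue_ring_zero simps)
  next
    case 3
    then show ?thesis
      by (rule prod[where es = "[{(1, 0), (0, 1)}, {(1, 0), (0, 2)}, {(2, 0), (0, 2)}, {(2, 0), (0, 1)}]"])
        (simp_all add: small_residue_rings residue_ring_3 residue_ring_zero simps, auto)
  next
    case 4
    then show ?thesis
      by (rule prod[where es = "[{(1, 0, 0), (0, 0, 1)}, {(1, 0, 0), (0, 1, 0)}, {(1, 0, 0), (0, 1, 1)}]"])
        (simp_all add: small_residue_rings residue_ring_2 residue_ring_zero simps, simp add: GF4_def simps)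
  next
    case 5
    then show ?thesis by (rule outerplanar_if_iso_Z2_cubed)
  qed
qed

section \<open>The classification\<close>

theorem theorem3p9:
  fixes A :: "('a, 'b) ring_scheme"
  assumes "cring A"
    and "\<one>\<^bsub>A\<^esub> \<noteq> \<zero>\<^bsub>A\<^esub>"
    and "finite (carrier A)"
    and "\<not> local_ring A"
  shows "outerplanar (line_graph (essential_graph A)) \<longleftrightarrow>
      A \<simeq> RDirProd (residue_ring 2) (residue_ring 2) \<or>
      A \<simeq> RDirProd (residue_ring 2) (residue_ring 3) \<or>
      A \<simeq> RDirProd (residue_ring 3) (residue_ring 3) \<or>
      A \<simeq> RDirProd (residue_ring 2) GF4 \<or>
      A \<simeq> RDirProd (residue_ring 2) (RDirProd (residue_ring 2) (residue_ring 2))"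
  using cring.classification_if_outerplanar[OF assms] cring.outerplanar_if_classified[OF assms(1)]
  by (rule iffI)

end
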